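(* Let $f:\mathcal U_f\to\mathbb L^3$ be a light-like generalized cuspidal edge of general type along $\Gamma$ in $\mathbb L^3$. Then for each singular point $p:=(s,0)\in\Sigma_f$ there exists a sufficiently small neighborhood $V_p\subset\mathcal U_f$ of $p$ such that the following assertions hold: (1) The sign $\sigma^C(p)$ does not vanish for each $p\in\Sigma_f$. (2) $f$ is time-like on $V_p\setminus\Sigma_f$. (3) The mean curvature $H^L$ is bounded on $V_p\setminus\Sigma_f$. (4) If $p$ is a cuspidal edge singular point, then the Gaussian curvature $K^L$ is unbounded and takes different signs on the two sides of $\Sigma_f$ in $V_p$. (5) If $p$ is a cuspidal edge singular point, then the two principal curvatures of $f$ are both unbounded on $V_p$, and they are real-valued on one side of $\Sigma_f$ and not real-valued on the other side in $V_p$. (6) Umbilical points and quasi-umbilical points of $f$ never accumulate at any cuspidal edge singular point of $f$.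
   Context: $\mathbb L^3$ is $\mathbb R^3$ with $\langle a,b\rangle_L=a_1b_1+a_2b_2-a_3b_3$; a vector $a\ne0$ is light-like if $\langle a,a\rangle_L=0$. A generalized cuspidal edge along $\Gamma$ is a $C^\infty$-map $f:\mathcal U_f=I\times(-\delta,\delta)\to\mathbb R^3$ ($I$ an open interval, $\delta>0$) with $\Gamma(s)=f(s,0)$ a regular curve, $f_t(s,0)=0$, and $f_{tt}(s,0),\Gamma'(s)$ linearly independent for all $s\in I$; $\Sigma_f=\{(s,0):s\in I\}$. A point $(s,0)$ is a cuspidal edge singular point if near it $f$ is equivalent to $(s,t)\mapsto(s,t^2,t^3)$ at the origin under local diffeomorphisms of source and target. With $E^L=\langle f_s,f_s\rangle_L$, $F^L=\langle f_s,f_t\rangle_L$, $G^L=\langle f_t,f_t\rangle_L$, put $\Delta_L=E^LG^L-(F^L)^2$. A regular point is space-like, time-like, light-like if $\Delta_L>0$, $<0$, $=0$. The order $i_p$ of $p=(s,0)$ is the smallest $k$ with $\partial^k\Delta_L/\partial t^k(s,0)\ne0$ ($\infty$ if none). $f$ is a light-like generalized cuspidal edge of general type along $\Gamma$ if it is a generalized cuspidal edge such that $\Gamma'(s)$ is light-like for every $s\in I$ (type $L$), $i_p=2$ for every $p\in\Sigma_f$, and $\Gamma''(s)\neq0$ for every $s\in I$. $\sigma^C(p)=\operatorname{sgn}\det(\Gamma'(s),f_{tt}(s,0),\Gamma''(s))$ for $p=(s,0)$. With $\tilde L=\det(f_s,f_t,f_{ss})$, $\tilde M=\det(f_s,f_t,f_{st})$,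 $\tilde N=\det(f_s,f_t,f_{tt})$, at regular points with $\Delta_L\ne0$: $K^L=-(\tilde L\tilde N-\tilde M^2)/\Delta_L^2$, $H^L=\frac{E^L\tilde N-2F^L\tilde M+G^L\tilde L}{2\Delta_L\sqrt{|\Delta_L|}}$, $W^L=\frac{1}{\Delta_L\sqrt{|\Delta_L|}}\begin{pmatrix}G^L&-F^L\\-F^L&E^L\end{pmatrix}\begin{pmatrix}\tilde L&\tilde M\\\tilde M&\tilde N\end{pmatrix}$. The principal curvatures are the (complex) eigenvalues of $W^L$. An umbilical (resp. quasi-umbilical) point is a space-like or time-like regular point where the two principal curvatures coincide and $W^L$ is diagonal (resp. not diagonal).
   Formalization: The condition Γ''(s)≠0 is replaced by linear independence of Γ'(s) and Γ''(s); with only Γ''≠0, assertion (1) fails, e.g. for f = e^s(1,0,1)+t²(0,1,1)+t³(1,0,0), and (1) itself forces this independence. *)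

theory Defs
  imports "HOL-Analysis.Analysis"
begin

section \<open>Smooth maps and diffeomorphisms\<close>

text \<open>Both notions are meant for open sets, where \<^term>\<open>frechet_derivative f (at x)\<close> is the
  total derivative; order k + 1 says that all directional derivatives are of class k.\<close>

primrec Ck_on :: "nat \<Rightarrow> 'a::euclidean_space set \<Rightarrow> ('a \<Rightarrow> 'b::euclidean_space) \<Rightarrow> bool" where
  "Ck_on 0 S f \<longleftrightarrow> continuous_on S f"
| "Ck_on (Suc k) S f \<longleftrightarrow> (\<forall>x\<in>S. f differentiable (at x)) \<and>
     (\<forall>v. Ck_on k S (\<lambda>x. frechet_derivative f (at x) v))"

definition smooth_on :: "'a::euclidean_space set \<Rightarrow> ('a \<Rightarrow> 'b::euclidean_space) \<Rightarrow> bool" where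
  "smooth_on S f \<longleftrightarrow> (\<forall>k. Ck_on k S f)"

definition diffeomorphism_betw ::
    "'a::euclidean_space set \<Rightarrow> 'b::euclidean_space set \<Rightarrow> ('a \<Rightarrow> 'b) \<Rightarrow> bool" where
  "diffeomorphism_betw S T \<phi> \<longleftrightarrow> open S \<and> open T \<and> bij_betw \<phi> S T \<and>
     smooth_on S \<phi> \<and> smooth_on T (inv_into S \<phi>)"


section \<open>Partial derivatives and Lorentz-Minkowski space\<close>

definition d_s :: "(real \<times> real \<Rightarrow> 'a::real_normed_vector) \<Rightarrow> real \<times> real \<Rightarrow> 'a" where
  "d_s g = (\<lambda>(s, t). vector_derivative (\<lambda>u. g (u, t)) (at s))"

definition d_t :: "(real \<times> real \<Rightarrow> 'a::real_normed_vector) \<Rightarrow> real \<times> real \<Rightarrow> 'a" where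
  "d_t g = (\<lambda>(s, t). vector_derivative (\<lambda>u. g (s, u)) (at t))"

definition linner :: "real^3 \<Rightarrow> real^3 \<Rightarrow> real" where
  "linner a b = a$1 * b$1 + a$2 * b$2 - a$3 * b$3"

definition light_like_vec :: "real^3 \<Rightarrow> bool" where
  "light_like_vec a \<longleftrightarrow> a \<noteq> 0 \<and> linner a a = 0"

definition lin_indep2 :: "real^3 \<Rightarrow> real^3 \<Rightarrow> bool" where
  "lin_indep2 a b \<longleftrightarrow> (\<forall>x y. x *\<^sub>R a + y *\<^sub>R b = 0 \<longrightarrow> x = 0 \<and> y = 0)"

definition det3 :: "real^3 \<Rightarrow> real^3 \<Rightarrow> real^3 \<Rightarrow> real" where
  "det3 a b c = det (vector [a, b, c] :: real^3^3)"


section \<open>Generalized cuspidal edges\<close>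

definition edge_domain :: "real set \<Rightarrow> real \<Rightarrow> (real \<times> real) set" where
  "edge_domain I \<delta> = I \<times> {-\<delta><..<\<delta>}"

definition edge_sing :: "real set \<Rightarrow> (real \<times> real) set" where
  "edge_sing I = I \<times> {0}"

definition edge_curve :: "(real \<times> real \<Rightarrow> real^3) \<Rightarrow> real \<Rightarrow> real^3" where
  "edge_curve f s = f (s, 0)"

definition edge_vel :: "(real \<times> real \<Rightarrow> real^3) \<Rightarrow> real \<Rightarrow> real^3" where
  "edge_vel f s = vector_derivative (edge_curve f) (at s)"

definition edge_acc :: "(real \<times> real \<Rightarrow> real^3) \<Rightarrow> real \<Rightarrow> real^3" where
  "edge_acc f s = vector_derivative (edge_vel f) (at s)"

definition generalized_cuspidal_edge ::
    "real set \<Rightarrow> real \<Rightarrow> (real \<times> real \<Rightarrow> real^3) \<Rightarrow> bool" where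
  "generalized_cuspidal_edge I \<delta> f \<longleftrightarrow>
     open I \<and> is_interval I \<and> I \<noteq> {} \<and> \<delta> > 0 \<and> smooth_on (edge_domain I \<delta>) f \<and>
     (\<forall>s\<in>I. edge_vel f s \<noteq> 0 \<and> d_t f (s, 0) = 0 \<and>
            lin_indep2 (d_t (d_t f) (s, 0)) (edge_vel f s))"

definition standard_cuspidal_edge :: "real \<times> real \<Rightarrow> real^3" where
  "standard_cuspidal_edge = (\<lambda>(s, t). vector [s, t^2, t^3])"

definition cuspidal_edge_point ::
    "real set \<Rightarrow> real \<Rightarrow> (real \<times> real \<Rightarrow> real^3) \<Rightarrow> real \<times> real \<Rightarrow> bool" where
  "cuspidal_edge_point I \<delta> f p \<longleftrightarrow> p \<in> edge_sing I \<and>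
     (\<exists>(M :: (real \<times> real) set) N P (Q :: (real^3) set) \<phi> \<psi>.
        N \<subseteq> edge_domain I \<delta> \<and> diffeomorphism_betw M N \<phi> \<and> (0, 0) \<in> M \<and> \<phi> (0, 0) = p \<and>
        diffeomorphism_betw P Q \<psi> \<and> f ` N \<subseteq> P \<and> \<psi> (f p) = 0 \<and>
        (\<forall>x\<in>M. \<psi> (f (\<phi> x)) = standard_cuspidal_edge x))"


section \<open>Fundamental forms and causal type\<close>

definition E_L :: "(real \<times> real \<Rightarrow> real^3) \<Rightarrow> real \<times> real \<Rightarrow> real" where
  "E_L f q = linner (d_s f q) (d_s f q)"

definition F_L :: "(real \<times> real \<Rightarrow> real^3) \<Rightarrow> real \<times> real \<Rightarrow> real" where
  "F_L f q = linner (d_s f q) (d_t f q)"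

definition G_L :: "(real \<times> real \<Rightarrow> real^3) \<Rightarrow> real \<times> real \<Rightarrow> real" where
  "G_L f q = linner (d_t f q) (d_t f q)"

definition Delta_L :: "(real \<times> real \<Rightarrow> real^3) \<Rightarrow> real \<times> real \<Rightarrow> real" where
  "Delta_L f q = E_L f q * G_L f q - (F_L f q)^2"

definition regular_point :: "(real \<times> real \<Rightarrow> real^3) \<Rightarrow> real \<times> real \<Rightarrow> bool" where
  "regular_point f q \<longleftrightarrow> lin_indep2 (d_s f q) (d_t f q)"

definition space_like_point :: "(real \<times> real \<Rightarrow> real^3) \<Rightarrow> real \<times> real \<Rightarrow> bool" where
  "space_like_point f q \<longleftrightarrow> regular_point f q \<and> Delta_L f q > 0"

definition time_like_point :: "(real \<times> real \<Rightarrow> real^3) \<Rightarrow> real \<times> real \<Rightarrow> bool" where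
  "time_like_point f q \<longleftrightarrow> regular_point f q \<and> Delta_L f q < 0"

text \<open>The infimum of the empty set in \<^typ>\<open>enat\<close> is infinity.\<close>

definition edge_order :: "(real \<times> real \<Rightarrow> real^3) \<Rightarrow> real \<times> real \<Rightarrow> enat" where
  "edge_order f p = Inf {enat k | k. (d_t ^^ k) (Delta_L f) p \<noteq> 0}"

text \<open>The condition that the second derivative of the light-like curve does not vanish has to be
  read independently of the parametrization, i.e. the velocity and the acceleration are linearly
  independent. Otherwise the light-like line s \<mapsto> (exp s, 0, exp s) would qualify, although it has
  acceleration zero after reparametrization. The two readings agree when the time coordinate of
  the curve is an affine function of the parameter; see lemma \<open>lin_indep2_light_like_iff\<close>.\<close>

definition light_like_general_type ::
    "real set \<Rightarrow> real \<Rightarrow> (real \<times> real \<Rightarrow> real^3) \<Rightarrow> bool" where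
  "light_like_general_type I \<delta> f \<longleftrightarrow> generalized_cuspidal_edge I \<delta> f \<and>
     (\<forall>s\<in>I. light_like_vec (edge_vel f s)) \<and>
     (\<forall>p\<in>edge_sing I. edge_order f p = 2) \<and>
     (\<forall>s\<in>I. lin_indep2 (edge_vel f s) (edge_acc f s))"

lemma lin_indep2_light_like_iff:
  assumes "light_like_vec v" "w $ 3 = 0"
  shows "lin_indep2 v w \<longleftrightarrow> w \<noteq> 0"
proof
  assume "lin_indep2 v w"
  then have "0 *\<^sub>R v + 1 *\<^sub>R w = 0 \<longrightarrow> (0::real) = 0 \<and> (1::real) = 0"
    unfolding lin_indep2_def by blast
  then show "w \<noteq> 0" by auto
next
  assume w: "w \<noteq> 0"
  have v3: "v $ 3 \<noteq> 0"
  proof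
    assume "v $ 3 = 0"
    then have "v$1 * v$1 + v$2 * v$2 = 0" "v$3 = 0"
      using assms(1) by (auto simp: light_like_vec_def linner_def)
    then have "v = 0"
      by (auto simp: vec_eq_iff forall_3 sum_squares_eq_zero_iff)
    then show False using assms(1) by (simp add: light_like_vec_def)
  qed
  show "lin_indep2 v w"
    unfolding lin_indep2_def
  proof (intro allI impI)
    fix x y :: real
    assume eq: "x *\<^sub>R v + y *\<^sub>R w = 0"
    then have "(x *\<^sub>R v + y *\<^sub>R w) $ 3 = 0" by simp
    then have "x = 0" using assms(2) v3 by simp
    with eq w show "x = 0 \<and> y = 0" by simp
  qed
qed

definition sigma_C :: "(real \<times> real \<Rightarrow> real^3) \<Rightarrow> real \<times> real \<Rightarrow> real" where
  "sigma_C f p = sgn (det3 (edge_vel f (fst p)) (d_t (d_t f) (fst p, 0)) (edge_acc f (fst p)))"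


section \<open>Curvatures\<close>

definition L_til :: "(real \<times> real \<Rightarrow> real^3) \<Rightarrow> real \<times> real \<Rightarrow> real" where
  "L_til f q = det3 (d_s f q) (d_t f q) (d_s (d_s f) q)"

definition M_til :: "(real \<times> real \<Rightarrow> real^3) \<Rightarrow> real \<times> real \<Rightarrow> real" where
  "M_til f q = det3 (d_s f q) (d_t f q) (d_t (d_s f) q)"

definition N_til :: "(real \<times> real \<Rightarrow> real^3) \<Rightarrow> real \<times> real \<Rightarrow> real" where
  "N_til f q = det3 (d_s f q) (d_t f q) (d_t (d_t f) q)"

text \<open>The following are meaningful only at points where \<^const>\<open>Delta_L\<close> does not vanish.\<close>

definition K_L :: "(real \<times> real \<Rightarrow> real^3) \<Rightarrow> real \<times> real \<Rightarrow> real" where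
  "K_L f q = - (L_til f q * N_til f q - (M_til f q)^2) / (Delta_L f q)^2"

definition H_L :: "(real \<times> real \<Rightarrow> real^3) \<Rightarrow> real \<times> real \<Rightarrow> real" where
  "H_L f q = (E_L f q * N_til f q - 2 * F_L f q * M_til f q + G_L f q * L_til f q) /
     (2 * Delta_L f q * sqrt \<bar>Delta_L f q\<bar>)"

definition W_L :: "(real \<times> real \<Rightarrow> real^3) \<Rightarrow> real \<times> real \<Rightarrow> real^2^2" where
  "W_L f q = (1 / (Delta_L f q * sqrt \<bar>Delta_L f q\<bar>)) *\<^sub>R
     ((vector [vector [G_L f q, - F_L f q], vector [- F_L f q, E_L f q]] :: real^2^2) **
      (vector [vector [L_til f q, M_til f q], vector [M_til f q, N_til f q]] :: real^2^2))"

definition complex_eigenvalues :: "real^2^2 \<Rightarrow> complex set" where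
  "complex_eigenvalues A =
     {\<mu>. \<exists>v::complex^2. v \<noteq> 0 \<and> (\<chi> i j. complex_of_real (A $ i $ j)) *v v = \<mu> *s v}"

definition principal_curvatures :: "(real \<times> real \<Rightarrow> real^3) \<Rightarrow> real \<times> real \<Rightarrow> complex set" where
  "principal_curvatures f q = complex_eigenvalues (W_L f q)"

text \<open>The spectrum determines the unordered pair of eigenvalues with multiplicity: it equals
  {l, m} exactly if l and m are the two eigenvalues, which coincide if it is a singleton.\<close>

lemma complex_eigenvalues_pair: "\<exists>l m. complex_eigenvalues A = {l, m}"
proof -
  define B :: "complex^2^2" where "B = (\<chi> i j. complex_of_real (A $ i $ j))"
  define T where "T = B$1$1 + B$2$2"
  define D where "D = B$1$1 * B$2$2 - B$1$2 * B$2$1"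
  define r where "r = csqrt (T^2 - 4 * D)"
  have r2: "r * r = T^2 - 4 * D"
    unfolding r_def by (metis power2_csqrt power2_eq_square)
  have ev: "(\<exists>v. v \<noteq> 0 \<and> B *v v = l *s v) \<longleftrightarrow> l = (T + r) / 2 \<or> l = (T - r) / 2" for l
  proof -
    have "B *v v = l *s v \<longleftrightarrow> (B - mat l) *v v = 0" for v
      by (auto simp: vec_eq_iff matrix_vector_mult_def mat_def sum_2 forall_2 algebra_simps)
    then have "(\<exists>v. v \<noteq> 0 \<and> B *v v = l *s v) \<longleftrightarrow> det (B - mat l) = 0"
      using matrix_left_invertible_ker[of "B - mat l"] invertible_left_inverse[of "B - mat l"]
        invertible_det_nz[of "B - mat l"] by auto
    also have "det (B - mat l) = (l - (T + r) / 2) * (l - (T - r) / 2)"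
    proof -
      have "4 * det (B - mat l) = (2 * l - T) * (2 * l - T) - r * r"
        unfolding r2 by (simp add: det_2 mat_def T_def D_def power2_eq_square algebra_simps)
      then show ?thesis by (simp add: field_simps)
    qed
    finally show ?thesis by simp
  qed
  have "complex_eigenvalues A = {(T + r) / 2, (T - r) / 2}"
    unfolding complex_eigenvalues_def B_def[symmetric] by (auto simp: ev)
  then show ?thesis by blast
qed

definition principal_curvatures_coincide :: "(real \<times> real \<Rightarrow> real^3) \<Rightarrow> real \<times> real \<Rightarrow> bool" where
  "principal_curvatures_coincide f q \<longleftrightarrow> (\<exists>l. principal_curvatures f q = {l})"

definition diagonal_matrix2 :: "real^2^2 \<Rightarrow> bool" where
  "diagonal_matrix2 A \<longleftrightarrow> (\<forall>i j. i \<noteq> j \<longrightarrow> A $ i $ j = 0)"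

definition umbilical_points ::
    "real set \<Rightarrow> real \<Rightarrow> (real \<times> real \<Rightarrow> real^3) \<Rightarrow> (real \<times> real) set" where
  "umbilical_points I \<delta> f = {q \<in> edge_domain I \<delta>.
     (space_like_point f q \<or> time_like_point f q) \<and> principal_curvatures_coincide f q \<and>
     diagonal_matrix2 (W_L f q)}"

definition quasi_umbilical_points ::
    "real set \<Rightarrow> real \<Rightarrow> (real \<times> real \<Rightarrow> real^3) \<Rightarrow> (real \<times> real) set" where
  "quasi_umbilical_points I \<delta> f = {q \<in> edge_domain I \<delta>.
     (space_like_point f q \<or> time_like_point f q) \<and> principal_curvatures_coincide f q \<and>
     \<not> diagonal_matrix2 (W_L f q)}"

end

theory Submission
  imports Defs
begin

text \<open>
  Near a point $(s_0,0)$ of the edge everything is governed by the vectors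
  $v=\Gamma'(s_0)$, $w=\Gamma''(s_0)$, $a=f_{tt}$, $b=f_{stt}$ and $c=f_{ttt}$ at $(s_0,0)$.
  Since $f_t$ vanishes on the edge, and with it $f_{st}$, the quotients $f_t/t$, $f_{st}/t$ and
  $(f_s(s,t)-f_s(s,0))/t^2$ converge to $a$, $b$ and $b/2$ as a point off the edge tends to $(s_0,0)$.
  All curvature quantities inherit leading terms from this. Because $\Gamma'$ is light-like,
  $E^L$ is of order $t^2$, not merely bounded; further $F^L\approx t\langle v,a\rangle_L$ and
  $G^L\approx t^2\langle a,a\rangle_L$, while $\tilde L\approx t\det(v,a,w)$, $\tilde M=O(t^2)$ and
  $\tilde N\approx t^2\det(v,a,c)/2$ (in $\tilde N$ one may replace $f_{tt}$ by $f_{tt}-f_t/t$, which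
  is itself of order $t$).

  Hence $\Delta_L\approx-t^2\langle v,a\rangle_L^2$, and the hypothesis that the order is $2$ says
  exactly that $\langle v,a\rangle_L\neq0$ (\<open>linner_v_a_nonzero\<close>). So $f$ is time-like off the edge.
  Moreover $v$ and $w$ span the Lorentz-orthogonal complement of the light-like vector $v$, and $a$ lies
  outside of it; this is $\det(v,a,w)\neq0$ (\<open>det3_light_like_nonzero\<close>). All three terms
  in the numerator of $H^L$ are $O(t^3)$, just as the denominator, so $H^L$ is bounded
  (\<open>H_bounded\<close>), whereas $tK^L$ converges to a multiple of $\det(v,a,w)\det(v,a,c)$ (\<open>K_limit\<close>).

  At a cuspidal edge point $\det(v,a,c)\neq0$: the normal form $(u,\nu^2,\nu^3)$ has this
  property, and coordinate changes preserve it because $f_t=0$ kills the second derivatives of the target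
  diffeomorphism up to the third order in $t$ (\<open>cuspidal_edge_point_det_nonzero\<close>). Then $K^L$ behaves
  like a nonzero multiple of $1/t$. The principal curvatures are the roots $\mu$ of
  $(\mu-H^L)^2=(H^L)^2-K^L$ where $\Delta_L<0$. With $H^L$ bounded, the right-hand side
  has the sign of $-K^L$ near the edge: so the roots are real on one side only, they never coincide, and
  neither of them can be bounded, since $K^L=2H^L\mu-\mu^2$.
\<close>

section \<open>Calculus of smooth maps on the plane\<close>

lemma Ck_on_cong:
  assumes "open S" "\<And>x. x \<in> S \<Longrightarrow> f x = g x" "Ck_on k S f"
  shows "Ck_on k S g"
  using assms(2,3)
proof (induction k arbitrary: f g)
  case 0
  then show ?case using continuous_on_cong by fastforce
next
  case (Suc k)
  have der: "(g has_derivative frechet_derivative f (at x)) (at x)" if "x \<in> S" for x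
    using Suc.prems that assms(1)
    by (auto intro: has_derivative_transform_within_open simp: frechet_derivative_works)
  then have "frechet_derivative f (at x) = frechet_derivative g (at x)" if "x \<in> S" for x
    using frechet_derivative_at that by blast
  then have "Ck_on k S (\<lambda>x. frechet_derivative g (at x) v)" for v
    using Suc.IH[of "\<lambda>x. frechet_derivative f (at x) v" "\<lambda>x. frechet_derivative g (at x) v"]
      Suc.prems by simp
  with der show ?case by (auto simp: differentiable_def)
qed

lemma smooth_on_cong:
  assumes "open S" "\<And>x. x \<in> S \<Longrightarrow> f x = g x" "smooth_on S f"
  shows "smooth_on S g"
  using assms Ck_on_cong unfolding smooth_on_def by blast

lemma smooth_on_has_derivative:
  assumes "smooth_on S g" "x \<in> S"
  shows "(g has_derivative frechet_derivative g (at x)) (at x)"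
  using assms unfolding smooth_on_def
  by (metis Ck_on.simps(2) frechet_derivative_works)

lemma smooth_on_frechet_derivative:
  assumes "smooth_on S g"
  shows "smooth_on S (\<lambda>x. frechet_derivative g (at x) v)"
  using assms unfolding smooth_on_def by (metis Ck_on.simps(2))

lemma smooth_on_continuous: "smooth_on S g \<Longrightarrow> continuous_on S g"
  unfolding smooth_on_def by (metis Ck_on.simps(1))

lemma has_vector_derivative_along_s:
  assumes "(g has_derivative g') (at (s, t :: real))"
  shows "((\<lambda>u::real. g (u, t)) has_vector_derivative g' (1, 0)) (at s)"
proof -
  have "((\<lambda>u. (u, t)) has_vector_derivative (1, 0)) (at s)"
    unfolding has_vector_derivative_def by (auto intro!: derivative_eq_intros)
  from vector_derivative_diff_chain_within[OF this, of g g'] show ?thesis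
    using has_derivative_at_withinI[OF assms] by (simp add: o_def)
qed

lemma has_vector_derivative_along_t:
  assumes "(g has_derivative g') (at (s :: real, t))"
  shows "((\<lambda>u::real. g (s, u)) has_vector_derivative g' (0, 1)) (at t)"
proof -
  have "((\<lambda>u. (s, u)) has_vector_derivative (0, 1)) (at t)"
    unfolding has_vector_derivative_def by (auto intro!: derivative_eq_intros)
  from vector_derivative_diff_chain_within[OF this, of g g'] show ?thesis
    using has_derivative_at_withinI[OF assms] by (simp add: o_def)
qed

lemma d_s_eqI:
  "(g has_derivative g') (at q) \<Longrightarrow> d_s g q = g' (1, 0)"
  using vector_derivative_at[OF has_vector_derivative_along_s[of g g' "fst q" "snd q"]]
  by (cases q) (simp add: d_s_def)

lemma d_t_eqI:
  "(g has_derivative g') (at q) \<Longrightarrow> d_t g q = g' (0, 1)"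
  using vector_derivative_at[OF has_vector_derivative_along_t[of g g' "fst q" "snd q"]]
  by (cases q) (simp add: d_t_def)

lemma smooth_on_d_s:
  fixes g :: "real \<times> real \<Rightarrow> 'b::euclidean_space"
  assumes "open S" "smooth_on S g"
  shows "smooth_on S (d_s g)"
  using smooth_on_cong[OF assms(1) _ smooth_on_frechet_derivative[OF assms(2)]]
    d_s_eqI[OF smooth_on_has_derivative[OF assms(2)]] by metis

lemma smooth_on_d_t:
  fixes g :: "real \<times> real \<Rightarrow> 'b::euclidean_space"
  assumes "open S" "smooth_on S g"
  shows "smooth_on S (d_t g)"
  using smooth_on_cong[OF assms(1) _ smooth_on_frechet_derivative[OF assms(2)]]
    d_t_eqI[OF smooth_on_has_derivative[OF assms(2)]] by metis

lemma smooth_on_has_d_s: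
  fixes g :: "real \<times> real \<Rightarrow> 'b::euclidean_space"
  assumes "smooth_on S g" "(s, t) \<in> S"
  shows "((\<lambda>u. g (u, t)) has_vector_derivative d_s g (s, t)) (at s)"
  using has_vector_derivative_along_s[OF smooth_on_has_derivative[OF assms]]
    d_s_eqI[OF smooth_on_has_derivative[OF assms]] by simp

lemma smooth_on_has_d_t:
  fixes g :: "real \<times> real \<Rightarrow> 'b::euclidean_space"
  assumes "smooth_on S g" "(s, t) \<in> S"
  shows "((\<lambda>u. g (s, u)) has_vector_derivative d_t g (s, t)) (at t)"
  using has_vector_derivative_along_t[OF smooth_on_has_derivative[OF assms]]
    d_t_eqI[OF smooth_on_has_derivative[OF assms]] by simp

text \<open>Asking for the bound only on the open segment matters when the segment starts on the
  edge, because asymptotic estimates of the derivative hold off the edge.\<close>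

lemma mean_value_bound:
  fixes g g' :: "real \<Rightarrow> 'a::real_inner"
  assumes der: "\<And>u. u \<in> closed_segment a b \<Longrightarrow> (g has_vector_derivative g' u) (at u)"
    and bound: "\<And>u. u \<in> open_segment a b \<Longrightarrow> norm (g' u) \<le> B"
  shows "norm (g b - g a) \<le> B * \<bar>b - a\<bar>"
proof -
  have main: "norm (g y - g x) \<le> B * (y - x)"
    if "x < y" "{x..y} = closed_segment a b" "{x<..<y} = open_segment a b" for x y
  proof -
    have "continuous_on {x..y} g"
      unfolding that(2)
      by (rule continuous_at_imp_continuous_on) (blast intro: has_vector_derivative_continuous der)
    moreover have "(g has_derivative (\<lambda>h. h *\<^sub>R g' u)) (at u)" if "x < u" "u < y" for u
    proof -
      have "u \<in> {x..y}" using that by simp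
      then show ?thesis
        using der \<open>{x..y} = closed_segment a b\<close> unfolding has_vector_derivative_def by simp
    qed
    ultimately obtain u where u: "u \<in> {x<..<y}" "norm (g y - g x) \<le> norm ((y - x) *\<^sub>R g' u)"
      using mvt_general[OF \<open>x < y\<close>, of g "\<lambda>u h. h *\<^sub>R g' u"] by blast
    have "norm (g' u) \<le> B" using bound u(1) that(3) by simp
    then have "norm ((y - x) *\<^sub>R g' u) \<le> B * (y - x)"
      using that(1) by (simp add: mult.commute[of B] mult_left_mono)
    with u(2) show ?thesis by (rule order_trans)
  qed
  consider "a < b" | "b < a" | "a = b" by linarith
  then show ?thesis
  proof cases
    case 1
    then show ?thesis
      using main[of a b] by (simp add: open_segment_eq_real_ivl closed_segment_eq_real_ivl)
  next
    case 2
    then show ?thesis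
      using main[of b a]
      by (simp add: open_segment_eq_real_ivl closed_segment_eq_real_ivl norm_minus_commute)
  qed simp
qed

text \<open>The asymptotics hold as both coordinates vary, and away from the edge only. This filter makes
  them uniform in $s$ near $s_0$, which is what yields statements on a full neighbourhood.\<close>

abbreviation off_axis :: "real \<Rightarrow> (real \<times> real) filter" where
  "off_axis s\<^sub>0 \<equiv> at (s\<^sub>0, 0) within {q. snd q \<noteq> 0}"

lemma eventually_off_axis_square:
  "eventually P (off_axis s\<^sub>0) \<longleftrightarrow>
    (\<exists>r>0. \<forall>s t. \<bar>s - s\<^sub>0\<bar> < r \<and> \<bar>t\<bar> < r \<and> t \<noteq> 0 \<longrightarrow> P (s, t))"
proof
  assume "eventually P (off_axis s\<^sub>0)"
  then obtain d where d: "d > 0" "\<And>x. snd x \<noteq> 0 \<Longrightarrow> x \<noteq> (s\<^sub>0, 0) \<Longrightarrow> dist x (s\<^sub>0, 0) < d \<Longrightarrow> P x"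
    unfolding eventually_at by auto
  have "P (s, t)" if "\<bar>s - s\<^sub>0\<bar> < d / 2" "\<bar>t\<bar> < d / 2" "t \<noteq> 0" for s t
  proof (rule d(2))
    have "norm (s - s\<^sub>0, t) \<le> norm (s - s\<^sub>0) + norm t" by (rule norm_Pair_le)
    then show "dist (s, t) (s\<^sub>0, 0) < d" using that by (simp add: dist_norm)
  qed (use that in auto)
  then show "\<exists>r>0. \<forall>s t. \<bar>s - s\<^sub>0\<bar> < r \<and> \<bar>t\<bar> < r \<and> t \<noteq> 0 \<longrightarrow> P (s, t)"
    using d(1) by (intro exI[of _ "d / 2"]) auto
next
  assume "\<exists>r>0. \<forall>s t. \<bar>s - s\<^sub>0\<bar> < r \<and> \<bar>t\<bar> < r \<and> t \<noteq> 0 \<longrightarrow> P (s, t)"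
  then obtain r where r: "r > 0" "\<And>s t. \<bar>s - s\<^sub>0\<bar> < r \<Longrightarrow> \<bar>t\<bar> < r \<Longrightarrow> t \<noteq> 0 \<Longrightarrow> P (s, t)"
    by blast
  show "eventually P (off_axis s\<^sub>0)"
    unfolding eventually_at
  proof (intro exI[of _ r] conjI ballI impI)
    fix x :: "real \<times> real"
    assume "x \<in> {q. snd q \<noteq> 0}" and "x \<noteq> (s\<^sub>0, 0) \<and> dist x (s\<^sub>0, 0) < r"
    then show "P x"
      using r(2)[of "fst x" "snd x"] dist_fst_le[of x "(s\<^sub>0, 0)"] dist_snd_le[of x "(s\<^sub>0, 0)"]
      by (simp add: dist_real_def)
  qed (fact r(1))
qed

lemma eventually_off_axis_nonzero: "\<forall>\<^sub>F q in off_axis s\<^sub>0. snd q \<noteq> 0"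
  by (simp add: eventually_at_filter)

lemma snd_limit: "(snd \<longlongrightarrow> 0) (off_axis s\<^sub>0)"
  using tendsto_snd[OF tendsto_ident_at, of "(s\<^sub>0, 0::real)"] by simp

lemma off_axis_nontrivial: "off_axis s\<^sub>0 \<noteq> bot"
proof
  assume "off_axis s\<^sub>0 = bot"
  then obtain r :: real where "r > 0" "\<forall>s t. \<bar>s - s\<^sub>0\<bar> < r \<and> \<bar>t\<bar> < r \<and> t \<noteq> 0 \<longrightarrow> False"
    using eventually_off_axis_square[of "\<lambda>_. False" s\<^sub>0] by auto
  then show False
    by (elim allE[of _ s\<^sub>0] allE[of _ "r / 2"]) auto
qed

lemma open_contains_square:
  fixes U :: "(real \<times> real) set"
  assumes "open U" "(s\<^sub>0, 0) \<in> U"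
  shows "\<exists>r>0. \<forall>s t. \<bar>s - s\<^sub>0\<bar> < r \<and> \<bar>t\<bar> < r \<longrightarrow> (s, t) \<in> U"
proof -
  obtain d where d: "d > 0" "\<And>x. dist x (s\<^sub>0, 0) < d \<Longrightarrow> x \<in> U"
    using assms unfolding open_dist by blast
  have "(s, t) \<in> U" if "\<bar>s - s\<^sub>0\<bar> < d / 2" "\<bar>t\<bar> < d / 2" for s t
  proof (rule d(2))
    have "norm (s - s\<^sub>0, t) \<le> norm (s - s\<^sub>0) + norm t" by (rule norm_Pair_le)
    then show "dist (s, t) (s\<^sub>0, 0) < d" using that by (simp add: dist_norm)
  qed
  then show ?thesis using d(1) by (intro exI[of _ "d / 2"]) auto
qed

text \<open>Asymptotic expansions in $t$ can be integrated: the difference between $h$ and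
  $t^{k+1}c/(k+1)$ vanishes on the axis and has a $t$-derivative of size $o(t^k)$. The mean value
  inequality bounds it by $o(t^{k+1})$.\<close>

lemma integrate_quotient_limit:
  fixes h h' :: "real \<times> real \<Rightarrow> 'a::real_inner"
  assumes U: "open U" "(s\<^sub>0, 0) \<in> U"
    and der: "\<And>s t. (s, t) \<in> U \<Longrightarrow> ((\<lambda>u. h (s, u)) has_vector_derivative h' (s, t)) (at t)"
    and zero: "\<And>s. (s, 0) \<in> U \<Longrightarrow> h (s, 0) = 0"
    and lim: "((\<lambda>q. h' q /\<^sub>R snd q ^ k) \<longlongrightarrow> c) (off_axis s\<^sub>0)"
  shows "((\<lambda>q. h q /\<^sub>R snd q ^ Suc k) \<longlongrightarrow> c /\<^sub>R real (Suc k)) (off_axis s\<^sub>0)"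
proof (rule tendstoI)
  fix e :: real assume "e > 0"
  then have e2: "e / 2 > 0" by simp
  obtain r\<^sub>1 where r1: "r\<^sub>1 > 0" "\<And>s t. \<bar>s - s\<^sub>0\<bar> < r\<^sub>1 \<Longrightarrow> \<bar>t\<bar> < r\<^sub>1 \<Longrightarrow> (s, t) \<in> U"
    using open_contains_square[OF U] by blast
  obtain r\<^sub>2 where r2: "r\<^sub>2 > 0"
    "\<And>s t. \<bar>s - s\<^sub>0\<bar> < r\<^sub>2 \<Longrightarrow> \<bar>t\<bar> < r\<^sub>2 \<Longrightarrow> t \<noteq> 0 \<Longrightarrow> dist (h' (s, t) /\<^sub>R t ^ k) c < e / 2"
    using tendstoD[OF lim e2] unfolding eventually_off_axis_square by auto
  have "dist (h (s, t) /\<^sub>R t ^ Suc k) (c /\<^sub>R real (Suc k)) < e"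
    if "\<bar>s - s\<^sub>0\<bar> < min r\<^sub>1 r\<^sub>2" "\<bar>t\<bar> < min r\<^sub>1 r\<^sub>2" "t \<noteq> 0" for s t
  proof -
    (* g is the error of the leading term; its derivative g' is small relative to u ^ k. *)
    define g where "g u = h (s, u) - (u ^ Suc k / real (Suc k)) *\<^sub>R c" for u
    define g' where "g' u = h' (s, u) - u ^ k *\<^sub>R c" for u
    have seg: "\<bar>u\<bar> \<le> \<bar>t\<bar>" if "u \<in> closed_segment 0 t" for u
      using that by (auto simp: closed_segment_eq_real_ivl split: if_splits)
    have "norm (g t - g 0) \<le> (e / 2 * \<bar>t\<bar> ^ k) * \<bar>t - 0\<bar>"
    proof (rule mean_value_bound)
      fix u assume u: "u \<in> closed_segment 0 t"
      have "(s, u) \<in> U" using r1(2) seg[OF u] that by force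
      moreover have "((\<lambda>u. u ^ Suc k / real (Suc k)) has_real_derivative u ^ k) (at u)"
        using DERIV_cdivide[OF DERIV_pow[of "Suc k" u UNIV], of "real (Suc k)"]
        by (simp del: of_nat_Suc)
      ultimately show "(g has_vector_derivative g' u) (at u)"
        unfolding g_def g'_def
        using has_vector_derivative_diff[OF der
            has_vector_derivative_scaleR[OF _ has_vector_derivative_const]]
        by fastforce
    next
      fix u assume u: "u \<in> open_segment 0 t"
      then have u0: "u \<noteq> 0" and ut: "\<bar>u\<bar> \<le> \<bar>t\<bar>"
        using seg by (auto simp: open_segment_def)
      then have "norm (h' (s, u) /\<^sub>R u ^ k - c) \<le> e / 2"
        using r2(2)[of s u] that by (simp add: dist_norm)
      then have "\<bar>u\<bar> ^ k * norm (h' (s, u) /\<^sub>R u ^ k - c) \<le> \<bar>t\<bar> ^ k * (e / 2)"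
        using ut by (intro mult_mono power_mono) auto
      moreover have "g' u = u ^ k *\<^sub>R (h' (s, u) /\<^sub>R u ^ k - c)"
        using u0 by (simp add: g'_def scaleR_diff_right)
      ultimately show "norm (g' u) \<le> e / 2 * \<bar>t\<bar> ^ k"
        by (simp add: power_abs mult.commute)
    qed
    moreover have "g 0 = 0" using zero[of s] r1 that by (simp add: g_def)
    ultimately have "norm (g t) \<le> e / 2 * \<bar>t ^ Suc k\<bar>"
      by (simp add: power_abs mult_ac abs_mult)
    moreover have "h (s, t) /\<^sub>R t ^ Suc k - c /\<^sub>R real (Suc k) = g t /\<^sub>R t ^ Suc k"
      using that by (simp add: g_def scaleR_diff_right divide_simps del: of_nat_Suc power_Suc)
    ultimately have "norm (h (s, t) /\<^sub>R t ^ Suc k - c /\<^sub>R real (Suc k)) \<le> e / 2"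
      using that by (simp add: divide_simps mult.commute del: power_Suc)
    then show ?thesis using \<open>e > 0\<close> by (simp add: dist_norm)
  qed
  then show "\<forall>\<^sub>F q in off_axis s\<^sub>0. dist (h q /\<^sub>R snd q ^ Suc k) (c /\<^sub>R real (Suc k)) < e"
    unfolding eventually_off_axis_square using r1(1) r2(1)
    by (intro exI[of _ "min r\<^sub>1 r\<^sub>2"]) auto
qed

lemma has_vector_derivative_quotient_limit:
  assumes "(g has_vector_derivative g') (at x)"
  shows "((\<lambda>y. (g y - g x) /\<^sub>R (y - x)) \<longlongrightarrow> g') (at x)"
proof -
  have "((\<lambda>y. norm (g y - g x - (y - x) *\<^sub>R g') / norm (y - x)) \<longlongrightarrow> 0) (at x)"
    using assms unfolding has_vector_derivative_def has_derivative_iff_norm by blast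
  moreover have "norm (g y - g x - (y - x) *\<^sub>R g') / norm (y - x)
      = norm ((g y - g x) /\<^sub>R (y - x) - g')" if "y \<noteq> x" for y
  proof -
    have "(g y - g x) /\<^sub>R (y - x) - g' = (g y - g x - (y - x) *\<^sub>R g') /\<^sub>R (y - x)"
      using that by (simp add: scaleR_diff_right)
    then show ?thesis by (simp add: divide_inverse_commute)
  qed
  ultimately have "((\<lambda>y. norm ((g y - g x) /\<^sub>R (y - x) - g')) \<longlongrightarrow> 0) (at x)"
    by (simp cong: Lim_cong_within)
  then show ?thesis by (metis Lim_null tendsto_norm_zero_iff)
qed

text \<open>The mean value inequality, applied once in each variable, compares the second difference of $g$ over a rectangle with area times
  $\partial_s\partial_t g$. Letting the rectangle shrink in $s$ first gives the derivative of
  $\partial_s g$ in $t$.\<close>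

lemma mixed_partials_commute:
  fixes g :: "real \<times> real \<Rightarrow> 'b::euclidean_space"
  assumes U: "open U" and g: "smooth_on U g" and q: "q \<in> U"
  shows "d_t (d_s g) q = d_s (d_t g) q"
proof -
  obtain s\<^sub>0 t\<^sub>0 where q_eq: "q = (s\<^sub>0, t\<^sub>0)" by fastforce
  define c where "c = d_s (d_t g) q"
  have cont: "continuous_on U (d_s (d_t g))"
    by (intro smooth_on_continuous smooth_on_d_s smooth_on_d_t U g)
  have "((\<lambda>t. d_s g (s\<^sub>0, t)) has_vector_derivative c) (at t\<^sub>0)"
    unfolding has_vector_derivative_def has_derivative_iff_norm
  proof (intro conjI bounded_linear_scaleR_left LIM_I)
    fix e :: real assume "e > 0"
    then have e2: "e / 2 > 0" by simp
    obtain d where d: "d > 0" "\<And>x. dist x q < d \<Longrightarrow> x \<in> U \<and> dist (d_s (d_t g) x) c < e / 2"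
    proof -
      have "isCont (d_s (d_t g)) q" using cont U q continuous_on_eq_continuous_at by blast
      then have "\<forall>\<^sub>F x in nhds q. dist (d_s (d_t g) x) c < e / 2"
        unfolding isCont_def c_def using e2 tendsto_at_iff_tendsto_nhds tendstoD by blast
      moreover have "\<forall>\<^sub>F x in nhds q. x \<in> U" using U q eventually_nhds by blast
      ultimately have "\<forall>\<^sub>F x in nhds q. x \<in> U \<and> dist (d_s (d_t g) x) c < e / 2"
        by eventually_elim auto
      then show ?thesis using that unfolding eventually_nhds_metric by blast
    qed
    define r where "r = d / 2"
    have r: "r > 0" using d(1) by (simp add: r_def)
    have box: "(s, t) \<in> U" "norm (d_s (d_t g) (s, t) - c) \<le> e / 2"
      if "\<bar>s - s\<^sub>0\<bar> < r" "\<bar>t - t\<^sub>0\<bar> < r" for s t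
    proof -
      have "norm (s - s\<^sub>0, t - t\<^sub>0) \<le> norm (s - s\<^sub>0) + norm (t - t\<^sub>0)" by (rule norm_Pair_le)
      then have "dist (s, t) q < d" using that by (simp add: q_eq dist_norm r_def)
      from d(2)[OF this] show "(s, t) \<in> U" "norm (d_s (d_t g) (s, t) - c) \<le> e / 2"
        by (auto simp: dist_norm)
    qed
    have seg: "\<bar>u - a\<bar> < r" if "u \<in> closed_segment a b" "\<bar>b - a\<bar> < r" for u a b :: real
      using that by (auto simp: closed_segment_eq_real_ivl split: if_splits)
    (* The error of the second difference over a rectangle is small relative to its area. *)
    have two: "norm ((g (s, t) - g (s\<^sub>0, t) - (g (s, t\<^sub>0) - g (s\<^sub>0, t\<^sub>0)) - ((s - s\<^sub>0) * (t - t\<^sub>0)) *\<^sub>R c))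
        \<le> e / 2 * \<bar>s - s\<^sub>0\<bar> * \<bar>t - t\<^sub>0\<bar>"
      if st: "\<bar>s - s\<^sub>0\<bar> < r" "\<bar>t - t\<^sub>0\<bar> < r" for s t
    proof -
      have inner: "norm (d_t g (s, u) - d_t g (s\<^sub>0, u) - (s - s\<^sub>0) *\<^sub>R c) \<le> e / 2 * \<bar>s - s\<^sub>0\<bar>"
        if u: "\<bar>u - t\<^sub>0\<bar> < r" for u
      proof -
        have "norm ((d_t g (s, u) - (s - s\<^sub>0) *\<^sub>R c) - (d_t g (s\<^sub>0, u) - (s\<^sub>0 - s\<^sub>0) *\<^sub>R c)) \<le> e / 2 * \<bar>s - s\<^sub>0\<bar>"
        proof (rule mean_value_bound)
          fix v assume v: "v \<in> closed_segment s\<^sub>0 s"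
          then have "(v, u) \<in> U" using box seg st u by blast
          then show "((\<lambda>v. d_t g (v, u) - (v - s\<^sub>0) *\<^sub>R c) has_vector_derivative
              d_s (d_t g) (v, u) - c) (at v)"
            by (auto intro!: derivative_eq_intros smooth_on_has_d_s smooth_on_d_t U g)
        next
          fix v assume v: "v \<in> open_segment s\<^sub>0 s"
          then show "norm (d_s (d_t g) (v, u) - c) \<le> e / 2"
            using box seg st u unfolding open_segment_def by blast
        qed
        then show ?thesis by (simp add: algebra_simps)
      qed
      let ?k = "\<lambda>u. g (s, u) - g (s\<^sub>0, u) - ((s - s\<^sub>0) * (u - t\<^sub>0)) *\<^sub>R c"
      have "norm (?k t - ?k t\<^sub>0) \<le> e / 2 * \<bar>s - s\<^sub>0\<bar> * \<bar>t - t\<^sub>0\<bar>"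
      proof (rule mean_value_bound)
        fix u assume u: "u \<in> closed_segment t\<^sub>0 t"
        then have "(s, u) \<in> U" "(s\<^sub>0, u) \<in> U" using box seg st r by force+
        then show "(?k has_vector_derivative
            d_t g (s, u) - d_t g (s\<^sub>0, u) - (s - s\<^sub>0) *\<^sub>R c) (at u)"
          by (auto intro!: derivative_eq_intros smooth_on_has_d_t g)
      next
        fix u assume u: "u \<in> open_segment t\<^sub>0 t"
        then show "norm (d_t g (s, u) - d_t g (s\<^sub>0, u) - (s - s\<^sub>0) *\<^sub>R c) \<le> e / 2 * \<bar>s - s\<^sub>0\<bar>"
          using inner seg st unfolding open_segment_def by blast
      qed
      then show ?thesis by (simp add: algebra_simps)
    qed
    (* Division by the side in direction s, which then tends to 0. *)
    have one: "norm (d_s g (s\<^sub>0, t) - d_s g (s\<^sub>0, t\<^sub>0) - (t - t\<^sub>0) *\<^sub>R c) \<le> e / 2 * \<bar>t - t\<^sub>0\<bar>"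
      if t: "\<bar>t - t\<^sub>0\<bar> < r" for t
    proof -
      have "(s\<^sub>0, t) \<in> U" "(s\<^sub>0, t\<^sub>0) \<in> U" using box t r by force+
      then have "((\<lambda>s. g (s, t) - g (s, t\<^sub>0) - ((s - s\<^sub>0) * (t - t\<^sub>0)) *\<^sub>R c) has_vector_derivative
            d_s g (s\<^sub>0, t) - d_s g (s\<^sub>0, t\<^sub>0) - (t - t\<^sub>0) *\<^sub>R c) (at s\<^sub>0)"
        by (auto intro!: derivative_eq_intros smooth_on_has_d_s g)
      from has_vector_derivative_quotient_limit[OF this]
      have lim: "((\<lambda>s. norm ((g (s, t) - g (s\<^sub>0, t) - (g (s, t\<^sub>0) - g (s\<^sub>0, t\<^sub>0)) -
            ((s - s\<^sub>0) * (t - t\<^sub>0)) *\<^sub>R c) /\<^sub>R (s - s\<^sub>0)))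
          \<longlongrightarrow> norm (d_s g (s\<^sub>0, t) - d_s g (s\<^sub>0, t\<^sub>0) - (t - t\<^sub>0) *\<^sub>R c)) (at s\<^sub>0)"
        by (intro tendsto_norm) (simp add: algebra_simps)
      have scale: "norm (x /\<^sub>R d) \<le> B" if "norm x \<le> B * \<bar>d\<bar>" "d \<noteq> 0" for x :: 'b and B d :: real
        using that by (simp add: divide_simps mult.commute)
      have "\<forall>\<^sub>F s in at s\<^sub>0. s \<noteq> s\<^sub>0 \<and> \<bar>s - s\<^sub>0\<bar> < r"
        using r unfolding eventually_at by (auto simp: dist_real_def)
      then have "\<forall>\<^sub>F s in at s\<^sub>0. norm ((g (s, t) - g (s\<^sub>0, t) - (g (s, t\<^sub>0) - g (s\<^sub>0, t\<^sub>0)) -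
            ((s - s\<^sub>0) * (t - t\<^sub>0)) *\<^sub>R c) /\<^sub>R (s - s\<^sub>0)) \<le> e / 2 * \<bar>t - t\<^sub>0\<bar>"
      proof eventually_elim
        case (elim s)
        then show ?case using two[of s t] t by (intro scale) (simp_all add: mult_ac)
      qed
      with lim show ?thesis by (intro tendsto_upperbound[OF lim]) auto
    qed
    show "\<exists>d>0. \<forall>t. t \<noteq> t\<^sub>0 \<and> norm (t - t\<^sub>0) < d \<longrightarrow>
      norm (norm (d_s g (s\<^sub>0, t) - d_s g (s\<^sub>0, t\<^sub>0) - (t - t\<^sub>0) *\<^sub>R c) / norm (t - t\<^sub>0) - 0) < e"
    proof (intro exI[of _ r] conjI allI impI r)
      fix t assume t: "t \<noteq> t\<^sub>0 \<and> norm (t - t\<^sub>0) < r"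
      then have "norm (d_s g (s\<^sub>0, t) - d_s g (s\<^sub>0, t\<^sub>0) - (t - t\<^sub>0) *\<^sub>R c) / norm (t - t\<^sub>0) \<le> e / 2"
        using one[of t] by (simp add: divide_simps)
      with \<open>e > 0\<close> have "norm (d_s g (s\<^sub>0, t) - d_s g (s\<^sub>0, t\<^sub>0) - (t - t\<^sub>0) *\<^sub>R c) / norm (t - t\<^sub>0) < e"
        by linarith
      then show "norm (norm (d_s g (s\<^sub>0, t) - d_s g (s\<^sub>0, t\<^sub>0) - (t - t\<^sub>0) *\<^sub>R c) / norm (t - t\<^sub>0) - 0) < e"
        by simp
    qed
  qed
  then show ?thesis
    by (auto simp: q_eq c_def d_t_def intro!: vector_derivative_at)
qed

section \<open>Lorentzian linear algebra and the principal curvatures\<close>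

lemma det3_expand:
  "det3 x y z = x$1 * y$2 * z$3 + x$2 * y$3 * z$1 + x$3 * y$1 * z$2
    - x$1 * y$3 * z$2 - x$2 * y$1 * z$3 - x$3 * y$2 * z$1"
  by (simp add: det3_def det_3)

lemma tendsto_det3 [tendsto_intros]:
  assumes "(x \<longlongrightarrow> x') F" "(y \<longlongrightarrow> y') F" "(z \<longlongrightarrow> z') F"
  shows "((\<lambda>q. det3 (x q) (y q) (z q)) \<longlongrightarrow> det3 x' y' z') F"
  unfolding det3_expand by (intro tendsto_intros assms)

lemma tendsto_linner [tendsto_intros]:
  assumes "(x \<longlongrightarrow> x') F" "(y \<longlongrightarrow> y') F"
  shows "((\<lambda>q. linner (x q) (y q)) \<longlongrightarrow> linner x' y') F"
  unfolding linner_def by (intro tendsto_intros assms)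

lemma bounded_bilinear_linner: "bounded_bilinear linner"
proof
  show "\<exists>K. \<forall>a b. norm (linner a b) \<le> norm a * norm b * K"
  proof (intro exI allI)
    fix a b :: "real^3"
    have "\<bar>a $ i * b $ i\<bar> \<le> norm a * norm b" for i
      unfolding abs_mult by (intro mult_mono component_le_norm_cart) auto
    from this[of 1] this[of 2] this[of 3] show "norm (linner a b) \<le> norm a * norm b * 3"
      unfolding linner_def by simp
  qed
qed (simp_all add: linner_def algebra_simps)

text \<open>The Euclidean cross product of $v$ and $w$ is orthogonal to both. So is $v$ with its last
  component negated, as $\langle v,v\rangle_L=\langle v,w\rangle_L=0$. The two are therefore
  proportional, with a nonzero factor, and $\det(v,a,w)$ is a nonzero multiple of $\langle v,a\rangle_L$.\<close>

lemma det3_light_like_nonzero: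
  assumes v: "light_like_vec v" and vw: "linner v w = 0" "lin_indep2 v w" and va: "linner v a \<noteq> 0"
  shows "det3 v a w \<noteq> 0"
proof
  assume "det3 v a w = 0"
  have v3: "v$3 \<noteq> 0"
  proof
    assume "v$3 = 0"
    with v show False
      by (auto simp: light_like_vec_def linner_def sum_squares_eq_zero_iff vec_eq_iff forall_3)
  qed
  have null: "v$3 * v$3 = v$1 * v$1 + v$2 * v$2" "v$3 * w$3 = v$1 * w$1 + v$2 * w$2"
    using v vw(1) by (simp_all add: light_like_vec_def linner_def)
  (* The proportionality above, read off in the third component and paired with a. *)
  have "v$3 * det3 v a w = (v$1 * w$2 - v$2 * w$1) * linner v a"
    unfolding det3_expand linner_def using null by algebra
  then have cross: "v$1 * w$2 = v$2 * w$1"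
    using \<open>det3 v a w = 0\<close> va by simp
  have "v$1 * w$3 = w$1 * v$3" "v$2 * w$3 = w$2 * v$3"
  proof -
    have "v$3 * (v$1 * w$3) = v$3 * (w$1 * v$3)" "v$3 * (v$2 * w$3) = v$3 * (w$2 * v$3)"
      using null cross by algebra+
    then show "v$1 * w$3 = w$1 * v$3" "v$2 * w$3 = w$2 * v$3" using v3 by simp_all
  qed
  then have "w$3 *\<^sub>R v + (- v$3) *\<^sub>R w = 0"
    by (simp add: vec_eq_iff forall_3 mult.commute)
  then show False using vw(2) v3 unfolding lin_indep2_def by (metis neg_equal_0_iff_equal)
qed

text \<open>$\Delta_L$ is the Gram determinant of $f_s$ and $f_t$ for the Lorentz product, and a Gram
  determinant vanishes on dependent vectors whatever the signature.\<close>

lemma regular_point_if_Delta_nonzero: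
  assumes "Delta_L f q \<noteq> 0"
  shows "regular_point f q"
  unfolding regular_point_def lin_indep2_def
proof (intro allI impI)
  fix x y :: real
  assume eq: "x *\<^sub>R d_s f q + y *\<^sub>R d_t f q = 0"
  interpret linner: bounded_bilinear linner by (fact bounded_bilinear_linner)
  have comm: "linner a b = linner b a" for a b by (simp add: linner_def mult.commute)
  have 1: "x * E_L f q + y * F_L f q = 0" "x * F_L f q + y * G_L f q = 0"
    using arg_cong[OF eq, of "\<lambda>z. linner (d_s f q) z"] arg_cong[OF eq, of "\<lambda>z. linner z (d_t f q)"]
    by (simp_all add: E_L_def F_L_def G_L_def linner.add_left linner.add_right
        linner.scaleR_left linner.scaleR_right linner.zero_right linner.zero_left)
  have "x * Delta_L f q = 0" "y * Delta_L f q = 0"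
    using 1 unfolding Delta_L_def by algebra+
  then show "x = 0 \<and> y = 0" using assms by simp
qed

lemma complex_eigenvalues_iff:
  "\<mu> \<in> complex_eigenvalues A \<longleftrightarrow>
    \<mu>\<^sup>2 - complex_of_real (A$1$1 + A$2$2) * \<mu> + complex_of_real (A$1$1 * A$2$2 - A$1$2 * A$2$1) = 0"
proof -
  define B :: "complex^2^2" where "B = (\<chi> i j. complex_of_real (A $ i $ j))"
  have "B *v v = \<mu> *s v \<longleftrightarrow> (B - mat \<mu>) *v v = 0" for v
    by (auto simp: vec_eq_iff matrix_vector_mult_def mat_def sum_2 forall_2 algebra_simps)
  then have "\<mu> \<in> complex_eigenvalues A \<longleftrightarrow> det (B - mat \<mu>) = 0"
    unfolding complex_eigenvalues_def B_def[symmetric]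
    using matrix_left_invertible_ker[of "B - mat \<mu>"] invertible_left_inverse[of "B - mat \<mu>"]
      invertible_det_nz[of "B - mat \<mu>"] by auto
  also have "det (B - mat \<mu>) =
      \<mu>\<^sup>2 - complex_of_real (A$1$1 + A$2$2) * \<mu> + complex_of_real (A$1$1 * A$2$2 - A$1$2 * A$2$1)"
    by (simp add: det_2 B_def mat_def power2_eq_square algebra_simps)
  finally show ?thesis .
qed

text \<open>The trace of $W^L$ is $2H^L$ for either sign of $\Delta_L$, but the determinant is $K^L$ only
  for $\Delta_L<0$: it contains $\Delta_L/|\Delta_L|$.\<close>

lemma principal_curvatures_iff:
  assumes "Delta_L f q < 0"
  shows "\<mu> \<in> principal_curvatures f q \<longleftrightarrow>
    (\<mu> - complex_of_real (H_L f q))\<^sup>2 = complex_of_real ((H_L f q)\<^sup>2 - K_L f q)"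
proof -
  define D where "D = Delta_L f q"
  define c where "c = 1 / (D * sqrt \<bar>D\<bar>)"
  have D: "D < 0" using assms by (simp add: D_def)
  have sq: "sqrt \<bar>D\<bar> * sqrt \<bar>D\<bar> = - D" using D by simp
  have W: "W_L f q $ 1 $ 1 = c * (G_L f q * L_til f q - F_L f q * M_til f q)"
    "W_L f q $ 1 $ 2 = c * (G_L f q * M_til f q - F_L f q * N_til f q)"
    "W_L f q $ 2 $ 1 = c * (E_L f q * M_til f q - F_L f q * L_til f q)"
    "W_L f q $ 2 $ 2 = c * (E_L f q * N_til f q - F_L f q * M_til f q)"
    unfolding W_L_def c_def D_def by (simp_all add: matrix_matrix_mult_def sum_2 algebra_simps)
  have tr: "W_L f q $ 1 $ 1 + W_L f q $ 2 $ 2 = 2 * H_L f q"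
    unfolding W H_L_def c_def D_def by (simp add: algebra_simps add_divide_distrib diff_divide_distrib)
  have c2: "c * c * D = - 1 / D\<^sup>2"
  proof -
    have "c * c = 1 / (D * D * (sqrt \<bar>D\<bar> * sqrt \<bar>D\<bar>))" by (simp add: c_def)
    also have "\<dots> = 1 / (D * D * (- D))" unfolding sq ..
    finally show ?thesis using D by (simp add: power2_eq_square)
  qed
  have "W_L f q $ 1 $ 1 * W_L f q $ 2 $ 2 - W_L f q $ 1 $ 2 * W_L f q $ 2 $ 1
      = (c * c * D) * (L_til f q * N_til f q - (M_til f q)\<^sup>2)"
    unfolding W D_def Delta_L_def by algebra
  also have "\<dots> = K_L f q"
    unfolding c2 K_L_def D_def[symmetric] by (simp only: times_divide_eq_left mult_minus_left mult_1)
  finally have dt: "W_L f q $ 1 $ 1 * W_L f q $ 2 $ 2 - W_L f q $ 1 $ 2 * W_L f q $ 2 $ 1 = K_L f q" .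
  have "\<mu>\<^sup>2 - complex_of_real (2 * H_L f q) * \<mu> + complex_of_real (K_L f q) =
      (\<mu> - complex_of_real (H_L f q))\<^sup>2 - complex_of_real ((H_L f q)\<^sup>2 - K_L f q)"
    by (simp add: power2_eq_square algebra_simps)
  then show ?thesis
    unfolding principal_curvatures_def complex_eigenvalues_iff tr dt by (metis right_minus_eq)
qed

lemma principal_curvatures_real:
  assumes "Delta_L f q < 0" "K_L f q < (H_L f q)\<^sup>2"
  shows "principal_curvatures f q \<subseteq> \<real>"
proof
  fix \<mu> assume "\<mu> \<in> principal_curvatures f q"
  then have "(\<mu> - complex_of_real (H_L f q))\<^sup>2 = (complex_of_real (sqrt ((H_L f q)\<^sup>2 - K_L f q)))\<^sup>2"
    using principal_curvatures_iff[OF assms(1)] assms(2)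
    by (simp flip: of_real_power)
  then have "\<mu> - complex_of_real (H_L f q) \<in> \<real>"
    unfolding power2_eq_iff by (metis Reals_minus Reals_of_real)
  then show "\<mu> \<in> \<real>"
    using Reals_add[of "\<mu> - complex_of_real (H_L f q)" "complex_of_real (H_L f q)"] by simp
qed

lemma principal_curvatures_nonreal:
  assumes "Delta_L f q < 0" "(H_L f q)\<^sup>2 < K_L f q"
  shows "principal_curvatures f q \<inter> \<real> = {}"
proof (rule ccontr)
  assume "principal_curvatures f q \<inter> \<real> \<noteq> {}"
  then obtain x :: real where "complex_of_real x \<in> principal_curvatures f q"
    by (auto elim: Reals_cases)
  then have "complex_of_real ((x - H_L f q)\<^sup>2) = complex_of_real ((H_L f q)\<^sup>2 - K_L f q)"
    using principal_curvatures_iff[OF assms(1)] by simp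
  then have "(x - H_L f q)\<^sup>2 = (H_L f q)\<^sup>2 - K_L f q" by (simp only: of_real_eq_iff)
  then show False using assms(2) by (smt (verit) zero_le_power2)
qed

lemma principal_curvatures_not_coincide:
  assumes "Delta_L f q < 0" "(H_L f q)\<^sup>2 \<noteq> K_L f q"
  shows "\<not> principal_curvatures_coincide f q"
proof
  define r where "r = csqrt (complex_of_real ((H_L f q)\<^sup>2 - K_L f q))"
  have r2: "r\<^sup>2 = complex_of_real ((H_L f q)\<^sup>2 - K_L f q)" by (simp add: r_def)
  with assms(2) have "r \<noteq> 0"
    by (metis of_real_eq_0_iff right_minus_eq zero_power2)
  have "complex_of_real (H_L f q) + r \<in> principal_curvatures f q"
       "complex_of_real (H_L f q) - r \<in> principal_curvatures f q"
    unfolding principal_curvatures_iff[OF assms(1)] using r2 by simp_all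
  moreover assume "principal_curvatures_coincide f q"
  ultimately have "complex_of_real (H_L f q) + r = complex_of_real (H_L f q) - r"
    unfolding principal_curvatures_coincide_def by auto
  with \<open>r \<noteq> 0\<close> show False by simp
qed

text \<open>A single principal curvature determines $K^L$ by $K^L=2H^L\mu-\mu^2$. Where $H^L$ is
  bounded, each of the two is therefore as unbounded as $K^L$.\<close>

lemma norm_K_L_le:
  assumes "Delta_L f q < 0" "\<mu> \<in> principal_curvatures f q" "norm \<mu> \<le> B" "\<bar>H_L f q\<bar> \<le> C"
  shows "\<bar>K_L f q\<bar> \<le> 2 * C * B + B\<^sup>2"
proof -
  have "(\<mu> - complex_of_real (H_L f q))\<^sup>2 = complex_of_real ((H_L f q)\<^sup>2 - K_L f q)"
    using assms principal_curvatures_iff by blast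
  then have "complex_of_real (K_L f q) = 2 * complex_of_real (H_L f q) * \<mu> - \<mu>\<^sup>2"
    by (simp add: power2_eq_square algebra_simps)
  then have "\<bar>K_L f q\<bar> = norm (2 * complex_of_real (H_L f q) * \<mu> - \<mu>\<^sup>2)"
    by (metis norm_of_real real_norm_def)
  also have "\<dots> \<le> 2 * \<bar>H_L f q\<bar> * norm \<mu> + (norm \<mu>)\<^sup>2"
    by (rule order_trans[OF norm_triangle_ineq4]) (simp add: norm_mult norm_power)
  also have "\<dots> \<le> 2 * C * B + B\<^sup>2"
    using assms(3,4) by (intro add_mono mult_mono power_mono) auto
  finally show ?thesis .
qed

section \<open>Leading terms of the fundamental forms at the edge\<close>

locale generalized_cuspidal_edge_at =
  fixes I :: "real set" and \<delta> :: real and f :: "real \<times> real \<Rightarrow> real^3" and s\<^sub>0 :: real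
  assumes edge: "generalized_cuspidal_edge I \<delta> f" and s0: "s\<^sub>0 \<in> I"
begin

abbreviation "U \<equiv> edge_domain I \<delta>"

text \<open>The derivatives of $f$ at the point of the edge that occur in the leading terms; $v$ and $w$ are
  $\Gamma'$ and $\Gamma''$.\<close>

definition "v = d_s f (s\<^sub>0, 0)"
definition "w = d_s (d_s f) (s\<^sub>0, 0)"
definition "a = d_t (d_t f) (s\<^sub>0, 0)"
definition "b = d_t (d_t (d_s f)) (s\<^sub>0, 0)"
definition "c = d_t (d_t (d_t f)) (s\<^sub>0, 0)"

lemma open_U: "open U"
  using edge unfolding generalized_cuspidal_edge_def edge_domain_def by (auto intro: open_Times)

lemma axis_in_U: "(s, 0) \<in> U \<longleftrightarrow> s \<in> I"
  using edge unfolding generalized_cuspidal_edge_def edge_domain_def by auto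

lemma smooth_f: "smooth_on U f"
  using edge unfolding generalized_cuspidal_edge_def by auto

lemmas smooth_derivs = smooth_f smooth_on_d_s[OF open_U] smooth_on_d_t[OF open_U]

lemma f_t_axis: "s \<in> I \<Longrightarrow> d_t f (s, 0) = 0"
  using edge unfolding generalized_cuspidal_edge_def by auto

lemma f_st_axis:
  assumes "s \<in> I"
  shows "d_t (d_s f) (s, 0) = 0"
proof -
  have "((\<lambda>u. d_t f (u, 0)) has_vector_derivative 0) (at s)"
  proof (rule has_vector_derivative_transform_within_open)
    show "open I" using edge unfolding generalized_cuspidal_edge_def by auto
  qed (use assms f_t_axis in auto)
  then have "d_s (d_t f) (s, 0) = 0"
    by (simp add: d_s_def vector_derivative_at)
  then show ?thesis
    using mixed_partials_commute[OF open_U smooth_f] assms axis_in_U by simp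
qed

lemma smooth_isCont:
  fixes g :: "real \<times> real \<Rightarrow> 'b::euclidean_space"
  assumes "smooth_on U g"
  shows "isCont g (s\<^sub>0, 0)"
  using smooth_on_continuous[OF assms] open_U axis_in_U s0 continuous_on_eq_continuous_at by blast

lemma smooth_limit:
  fixes g :: "real \<times> real \<Rightarrow> 'b::euclidean_space"
  assumes "smooth_on U g"
  shows "(g \<longlongrightarrow> g (s\<^sub>0, 0)) (off_axis s\<^sub>0)"
  using smooth_isCont[OF assms] unfolding isCont_def by (rule tendsto_mono[rotated]) (simp add: at_le)

lemma smooth_limit_axis:
  fixes g :: "real \<times> real \<Rightarrow> 'b::euclidean_space"
  assumes "smooth_on U g"
  shows "((\<lambda>q. g (fst q, 0)) \<longlongrightarrow> g (s\<^sub>0, 0)) (off_axis s\<^sub>0)"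
proof (rule isCont_tendsto_compose[OF smooth_isCont[OF assms]])
  show "((\<lambda>q. (fst q, 0)) \<longlongrightarrow> (s\<^sub>0, 0)) (off_axis s\<^sub>0)"
    using tendsto_fst[OF tendsto_ident_at, of "(s\<^sub>0, 0::real)"] by (intro tendsto_Pair) auto
qed

lemma quotient_limit:
  fixes h h' :: "real \<times> real \<Rightarrow> 'b::euclidean_space"
  assumes "\<And>s t. (s, t) \<in> U \<Longrightarrow> ((\<lambda>u. h (s, u)) has_vector_derivative h' (s, t)) (at t)"
    and "\<And>s. s \<in> I \<Longrightarrow> h (s, 0) = 0"
    and "((\<lambda>q. h' q /\<^sub>R snd q ^ k) \<longlongrightarrow> z) (off_axis s\<^sub>0)"
  shows "((\<lambda>q. h q /\<^sub>R snd q ^ Suc k) \<longlongrightarrow> z /\<^sub>R real (Suc k)) (off_axis s\<^sub>0)"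
  using integrate_quotient_limit[OF open_U _ assms(1) _ assms(3)] assms(2) axis_in_U s0 by auto

lemma f_t_limit: "((\<lambda>q. d_t f q /\<^sub>R snd q) \<longlongrightarrow> a) (off_axis s\<^sub>0)"
  using quotient_limit[of "d_t f" "d_t (d_t f)" 0 a]
    smooth_on_has_d_t[of U "d_t f"] smooth_limit[of "d_t (d_t f)"] f_t_axis
  by (simp add: smooth_derivs a_def)

lemma f_st_limit: "((\<lambda>q. d_t (d_s f) q /\<^sub>R snd q) \<longlongrightarrow> b) (off_axis s\<^sub>0)"
  using quotient_limit[of "d_t (d_s f)" "d_t (d_t (d_s f))" 0 b]
    smooth_on_has_d_t[of U "d_t (d_s f)"] smooth_limit[of "d_t (d_t (d_s f))"] f_st_axis
  by (simp add: smooth_derivs b_def)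

lemma f_s_limit:
  "((\<lambda>q. (d_s f q - d_s f (fst q, 0)) /\<^sub>R snd q ^ 2) \<longlongrightarrow> b /\<^sub>R 2) (off_axis s\<^sub>0)"
proof -
  have "((\<lambda>u. d_s f (s, u) - d_s f (s, 0)) has_vector_derivative d_t (d_s f) (s, t)) (at t)"
    if "(s, t) \<in> U" for s t
    using smooth_on_has_d_t[of U "d_s f", OF _ that]
    by (simp add: smooth_derivs has_vector_derivative_diff_const)
  then show ?thesis
    using quotient_limit[of "\<lambda>q. d_s f q - d_s f (fst q, 0)" "d_t (d_s f)" 1 b] f_st_limit
    by (simp add: numeral_2_eq_2)
qed

text \<open>Replacing $f_{tt}$ by $f_{tt}-f_t/t$ does not change $\tilde N$, and by this limit it exhibits the
  additional factor $t$ in $\tilde N$. The $t$-derivative of $tf_{tt}-f_t$ is $tf_{ttt}$, since the terms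
  with $f_{tt}$ cancel.\<close>

lemma f_tt_limit:
  "((\<lambda>q. (snd q *\<^sub>R d_t (d_t f) q - d_t f q) /\<^sub>R snd q ^ 2) \<longlongrightarrow> c /\<^sub>R 2) (off_axis s\<^sub>0)"
proof -
  have der: "((\<lambda>u. u *\<^sub>R d_t (d_t f) (s, u) - d_t f (s, u)) has_vector_derivative
      t *\<^sub>R d_t (d_t (d_t f)) (s, t)) (at t)" if "(s, t) \<in> U" for s t
    using has_vector_derivative_diff[OF has_vector_derivative_scaleR[OF DERIV_ident
          smooth_on_has_d_t[of U "d_t (d_t f)", OF _ that]] smooth_on_has_d_t[of U "d_t f", OF _ that]]
    by (simp add: smooth_derivs)
  have "((\<lambda>q. (snd q *\<^sub>R d_t (d_t (d_t f)) q) /\<^sub>R snd q ^ 1) \<longlongrightarrow> c) (off_axis s\<^sub>0)"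
  proof (rule Lim_transform_eventually)
    show "(d_t (d_t (d_t f)) \<longlongrightarrow> c) (off_axis s\<^sub>0)"
      unfolding c_def by (intro smooth_limit smooth_derivs)
    show "\<forall>\<^sub>F q in off_axis s\<^sub>0. d_t (d_t (d_t f)) q = (snd q *\<^sub>R d_t (d_t (d_t f)) q) /\<^sub>R snd q ^ 1"
      using eventually_off_axis_nonzero by eventually_elim simp
  qed
  then show ?thesis
    using quotient_limit[of "\<lambda>q. snd q *\<^sub>R d_t (d_t f) q - d_t f q"
        "\<lambda>q. snd q *\<^sub>R d_t (d_t (d_t f)) q" 1 c] der f_t_axis
    by (simp add: numeral_2_eq_2)
qed

lemma f_taylor_2: "((\<lambda>q. (f q - f (fst q, 0)) /\<^sub>R snd q ^ 2) \<longlongrightarrow> a /\<^sub>R 2) (off_axis s\<^sub>0)"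
proof -
  have "((\<lambda>u. f (s, u) - f (s, 0)) has_vector_derivative d_t f (s, t)) (at t)"
    if "(s, t) \<in> U" for s t
    using smooth_on_has_d_t[of U f, OF _ that]
    by (simp add: smooth_derivs has_vector_derivative_diff_const)
  then show ?thesis
    using quotient_limit[of "\<lambda>q. f q - f (fst q, 0)" "d_t f" 1 a] f_t_limit
    by (simp add: numeral_2_eq_2)
qed

lemma f_taylor_3:
  "((\<lambda>q. (f q - f (fst q, 0) - (snd q ^ 2 / 2) *\<^sub>R d_t (d_t f) (fst q, 0)) /\<^sub>R snd q ^ 3)
    \<longlongrightarrow> c /\<^sub>R 6) (off_axis s\<^sub>0)"
proof -
  let ?a = "\<lambda>s. d_t (d_t f) (s, 0)"
  have d2: "((\<lambda>u. d_t (d_t f) (s, u) - ?a s) has_vector_derivative d_t (d_t (d_t f)) (s, t)) (at t)"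
    if "(s, t) \<in> U" for s t
    using smooth_on_has_d_t[of U "d_t (d_t f)", OF _ that]
    by (simp add: smooth_derivs has_vector_derivative_diff_const)
  have l2: "((\<lambda>q. (d_t (d_t f) q - ?a (fst q)) /\<^sub>R snd q ^ Suc 0) \<longlongrightarrow> c /\<^sub>R real (Suc 0)) (off_axis s\<^sub>0)"
    using smooth_limit[of "d_t (d_t (d_t f))"]
    by (intro quotient_limit[where h' = "d_t (d_t (d_t f))"]) (auto simp: smooth_derivs d2 c_def)
  have d1: "((\<lambda>u. d_t f (s, u) - u *\<^sub>R ?a s) has_vector_derivative
      d_t (d_t f) (s, t) - ?a s) (at t)"
    if "(s, t) \<in> U" for s t
    using smooth_on_has_d_t[of U "d_t f", OF _ that]
    by (auto intro!: derivative_eq_intros simp: smooth_derivs)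
  have l1: "((\<lambda>q. (d_t f q - snd q *\<^sub>R ?a (fst q)) /\<^sub>R snd q ^ Suc (Suc 0))
      \<longlongrightarrow> c /\<^sub>R real (Suc 0) /\<^sub>R real (Suc (Suc 0))) (off_axis s\<^sub>0)"
    by (rule quotient_limit[OF _ _ l2]) (auto simp: d1 f_t_axis)
  have d0: "((\<lambda>u. f (s, u) - f (s, 0) - (u ^ 2 / 2) *\<^sub>R ?a s) has_vector_derivative
      d_t f (s, t) - t *\<^sub>R ?a s) (at t)"
    if "(s, t) \<in> U" for s t
    using smooth_on_has_d_t[of U f, OF _ that]
    by (auto intro!: derivative_eq_intros simp: smooth_derivs)
  have l0: "((\<lambda>q. (f q - f (fst q, 0) - (snd q ^ 2 / 2) *\<^sub>R ?a (fst q)) /\<^sub>R snd q ^ Suc (Suc (Suc 0)))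
      \<longlongrightarrow> c /\<^sub>R real (Suc 0) /\<^sub>R real (Suc (Suc 0)) /\<^sub>R real (Suc (Suc (Suc 0)))) (off_axis s\<^sub>0)"
    by (rule quotient_limit[OF _ _ l1]) (auto simp: d0)
  then show ?thesis by (simp add: numeral_3_eq_3)
qed

lemma F_limit: "((\<lambda>q. F_L f q / snd q) \<longlongrightarrow> linner v a) (off_axis s\<^sub>0)"
proof -
  have "((\<lambda>q. linner (d_s f q) (d_t f q /\<^sub>R snd q)) \<longlongrightarrow> linner v a) (off_axis s\<^sub>0)"
    unfolding v_def by (intro tendsto_intros f_t_limit smooth_limit smooth_derivs)
  then show ?thesis
    by (rule Lim_transform_eventually) (simp add: F_L_def linner_def divide_inverse algebra_simps)
qed

lemma G_limit: "((\<lambda>q. G_L f q / snd q ^ 2) \<longlongrightarrow> linner a a) (off_axis s\<^sub>0)"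
proof -
  have "((\<lambda>q. linner (d_t f q /\<^sub>R snd q) (d_t f q /\<^sub>R snd q)) \<longlongrightarrow> linner a a) (off_axis s\<^sub>0)"
    by (intro tendsto_intros f_t_limit)
  then show ?thesis
    by (rule Lim_transform_eventually)
      (simp add: G_L_def linner_def power2_eq_square divide_inverse algebra_simps)
qed

lemma L_limit: "((\<lambda>q. L_til f q / snd q) \<longlongrightarrow> det3 v a w) (off_axis s\<^sub>0)"
proof -
  have "((\<lambda>q. det3 (d_s f q) (d_t f q /\<^sub>R snd q) (d_s (d_s f) q)) \<longlongrightarrow> det3 v a w) (off_axis s\<^sub>0)"
    unfolding v_def w_def by (intro tendsto_intros f_t_limit smooth_limit smooth_derivs)
  then show ?thesis
    by (rule Lim_transform_eventually)
      (simp add: L_til_def det3_expand divide_inverse algebra_simps)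
qed

lemma M_limit: "((\<lambda>q. M_til f q / snd q ^ 2) \<longlongrightarrow> det3 v a b) (off_axis s\<^sub>0)"
proof -
  have "((\<lambda>q. det3 (d_s f q) (d_t f q /\<^sub>R snd q) (d_t (d_s f) q /\<^sub>R snd q)) \<longlongrightarrow> det3 v a b) (off_axis s\<^sub>0)"
    unfolding v_def by (intro tendsto_intros f_t_limit f_st_limit smooth_limit smooth_derivs)
  then show ?thesis
    by (rule Lim_transform_eventually)
      (simp add: M_til_def det3_expand power2_eq_square divide_inverse algebra_simps)
qed

lemma N_limit: "((\<lambda>q. N_til f q / snd q ^ 2) \<longlongrightarrow> det3 v a c / 2) (off_axis s\<^sub>0)"
proof -
  have lim: "((\<lambda>q. det3 (d_s f q) (d_t f q /\<^sub>R snd q)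
      ((snd q *\<^sub>R d_t (d_t f) q - d_t f q) /\<^sub>R snd q ^ 2)) \<longlongrightarrow> det3 v a (c /\<^sub>R 2)) (off_axis s\<^sub>0)"
    unfolding v_def by (intro tendsto_intros f_t_limit f_tt_limit smooth_limit smooth_derivs)
  have half: "det3 v a (c /\<^sub>R 2) = det3 v a c / 2"
    by (simp add: det3_expand field_simps)
  have "\<forall>\<^sub>F q in off_axis s\<^sub>0. det3 (d_s f q) (d_t f q /\<^sub>R snd q)
      ((snd q *\<^sub>R d_t (d_t f) q - d_t f q) /\<^sub>R snd q ^ 2) = N_til f q / snd q ^ 2"
    using eventually_off_axis_nonzero
    by eventually_elim (simp add: N_til_def det3_expand field_simps power2_eq_square)
  from Lim_transform_eventually[OF lim this] show ?thesis unfolding half .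
qed

text \<open>With $f_s(s,t)=f_s(s,0)+t^2R$, the constant term of $E^L$ vanishes because the velocity of the
  edge is null at every $s$, not just at $s_0$. There is no linear term, because $f_{st}$
  vanishes on the edge.\<close>

lemma E_limit:
  assumes "\<And>s. s \<in> I \<Longrightarrow> linner (d_s f (s, 0)) (d_s f (s, 0)) = 0"
  shows "((\<lambda>q. E_L f q / snd q ^ 2) \<longlongrightarrow> linner v b) (off_axis s\<^sub>0)"
proof -
  define R where "R q = (d_s f q - d_s f (fst q, 0)) /\<^sub>R snd q ^ 2" for q
  have R: "(R \<longlongrightarrow> b /\<^sub>R 2) (off_axis s\<^sub>0)"
    unfolding R_def by (rule f_s_limit)
  have "((\<lambda>q. 2 * linner (d_s f (fst q, 0)) (R q) + snd q ^ 2 * linner (R q) (R q)) \<longlongrightarrow>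
      2 * linner v (b /\<^sub>R 2) + 0 ^ 2 * linner (b /\<^sub>R 2) (b /\<^sub>R 2)) (off_axis s\<^sub>0)"
    unfolding v_def by (intro tendsto_intros R snd_limit smooth_limit_axis smooth_derivs)
  moreover have "2 * linner v (b /\<^sub>R 2) + 0 ^ 2 * linner (b /\<^sub>R 2) (b /\<^sub>R 2) = linner v b"
    by (simp add: linner_def algebra_simps)
  moreover have "\<forall>\<^sub>F q in off_axis s\<^sub>0. 2 * linner (d_s f (fst q, 0)) (R q) + snd q ^ 2 * linner (R q) (R q)
      = E_L f q / snd q ^ 2"
  proof -
    obtain r where r: "r > 0" "\<And>s t. \<bar>s - s\<^sub>0\<bar> < r \<Longrightarrow> \<bar>t\<bar> < r \<Longrightarrow> (s, t) \<in> U"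
      using open_contains_square[OF open_U] axis_in_U s0 by blast
    have "\<forall>\<^sub>F q in off_axis s\<^sub>0. fst q \<in> I"
      unfolding eventually_off_axis_square using r by (intro exI[of _ r]) (auto simp: edge_domain_def)
    then show ?thesis
      using eventually_off_axis_nonzero
    proof eventually_elim
      case (elim q)
      have "d_s f q = d_s f (fst q, 0) + snd q ^ 2 *\<^sub>R R q"
        using elim by (simp add: R_def)
      then have "E_L f q = linner (d_s f (fst q, 0)) (d_s f (fst q, 0))
          + snd q ^ 2 * (2 * linner (d_s f (fst q, 0)) (R q) + snd q ^ 2 * linner (R q) (R q))"
        by (simp add: E_L_def linner_def algebra_simps power2_eq_square)
      then show ?case using assms[of "fst q"] elim by simp
    qed
  qed
  ultimately show ?thesis using Lim_transform_eventually by fastforce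
qed

end

section \<open>Light-like edges\<close>

context generalized_cuspidal_edge_at
begin

lemma has_real_derivative_linner_t:
  assumes "smooth_on U x" "smooth_on U y" "(s, t) \<in> U"
  shows "((\<lambda>u. linner (x (s, u)) (y (s, u))) has_real_derivative
    linner (x (s, t)) (d_t y (s, t)) + linner (d_t x (s, t)) (y (s, t))) (at t)"
  unfolding has_real_derivative_iff_has_vector_derivative
  by (intro bounded_bilinear.has_vector_derivative[OF bounded_bilinear_linner]
      smooth_on_has_d_t[OF assms(1,3)] smooth_on_has_d_t[OF assms(2,3)])

text \<open>On the edge $\partial_t^2\Delta_L=-2\langle v,a\rangle_L^2$: all other terms of the
  product rule contain one of $E^L$, $F^L$, $G^L$, $\partial_tE^L$, $\partial_tG^L$, which vanish there.
  If $\langle v,a\rangle_L$ were zero, the second $t$-derivative of $\Delta_L$ would vanish and the order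
  could not be $2$.\<close>

lemma linner_v_a_nonzero:
  assumes null: "linner v v = 0" and order: "edge_order f (s\<^sub>0, 0) = 2"
  shows "linner v a \<noteq> 0"
proof
  assume "linner v a = 0"
  define E where "E u = linner (d_s f (s\<^sub>0, u)) (d_s f (s\<^sub>0, u))" for u
  define F where "F u = linner (d_s f (s\<^sub>0, u)) (d_t f (s\<^sub>0, u))" for u
  define G where "G u = linner (d_t f (s\<^sub>0, u)) (d_t f (s\<^sub>0, u))" for u
  define E' where "E' u = linner (d_s f (s\<^sub>0, u)) (d_t (d_s f) (s\<^sub>0, u)) +
    linner (d_t (d_s f) (s\<^sub>0, u)) (d_s f (s\<^sub>0, u))" for u
  define F' where "F' u = linner (d_s f (s\<^sub>0, u)) (d_t (d_t f) (s\<^sub>0, u)) +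
    linner (d_t (d_s f) (s\<^sub>0, u)) (d_t f (s\<^sub>0, u))" for u
  define G' where "G' u = linner (d_t f (s\<^sub>0, u)) (d_t (d_t f) (s\<^sub>0, u)) +
    linner (d_t (d_t f) (s\<^sub>0, u)) (d_t f (s\<^sub>0, u))" for u
  have \<Delta>: "Delta_L f (s\<^sub>0, u) = E u * G u - F u * F u" for u
    by (simp add: Delta_L_def E_L_def F_L_def G_L_def E_def F_def G_def power2_eq_square)
  have der: "(E has_real_derivative E' u) (at u)" "(F has_real_derivative F' u) (at u)"
    "(G has_real_derivative G' u) (at u)" if "(s\<^sub>0, u) \<in> U" for u
    unfolding E_def F_def G_def E'_def F'_def G'_def
    by (intro has_real_derivative_linner_t smooth_derivs that)+
  have in_U: "(s\<^sub>0, 0) \<in> U" using axis_in_U s0 by simp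
  have "\<exists>E''. (E' has_real_derivative E'') (at 0)" "\<exists>F''. (F' has_real_derivative F'') (at 0)"
    "\<exists>G''. (G' has_real_derivative G'') (at 0)"
    unfolding E'_def F'_def G'_def
    by (rule exI, rule DERIV_add; rule has_real_derivative_linner_t; intro smooth_derivs in_U)+
  then obtain E'' F'' G'' where der2: "(E' has_real_derivative E'') (at 0)"
    "(F' has_real_derivative F'') (at 0)" "(G' has_real_derivative G'') (at 0)" by blast
  have linner_0: "linner x 0 = 0" "linner 0 x = 0" for x by (simp_all add: linner_def)
  have zero: "E 0 = 0" "F 0 = 0" "G 0 = 0" "E' 0 = 0" "F' 0 = 0" "G' 0 = 0"
    using null \<open>linner v a = 0\<close> f_t_axis[OF s0] f_st_axis[OF s0]
    by (simp_all add: E_def F_def G_def E'_def F'_def G'_def v_def a_def linner_0)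
  define D where "D u = E' u * G u + G' u * E u - (F' u * F u + F' u * F u)" for u
  have dD: "d_t (Delta_L f) (s\<^sub>0, u) = D u" if "(s\<^sub>0, u) \<in> U" for u
  proof -
    have "((\<lambda>u. Delta_L f (s\<^sub>0, u)) has_real_derivative D u) (at u)"
      unfolding \<Delta> D_def using der[OF that] by (auto intro!: derivative_eq_intros)
    then show ?thesis
      by (simp add: d_t_def has_real_derivative_iff_has_vector_derivative vector_derivative_at)
  qed
  have "(D has_real_derivative 0) (at 0)"
    unfolding D_def using der[OF in_U] der2 by (auto intro!: derivative_eq_intros simp: zero)
  then have "((\<lambda>u. d_t (Delta_L f) (s\<^sub>0, u)) has_vector_derivative 0) (at 0)"
    unfolding has_real_derivative_iff_has_vector_derivative
    by (rule has_vector_derivative_transform_within_open[where S = "{-\<delta><..<\<delta>}"])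
      (use in_U dD s0 in \<open>auto simp: edge_domain_def\<close>)
  then have "(d_t ^^ 2) (Delta_L f) (s\<^sub>0, 0) = 0"
    by (simp add: numeral_2_eq_2 d_t_def[of "d_t (Delta_L f)"] vector_derivative_at)
  moreover have "(d_t ^^ 2) (Delta_L f) (s\<^sub>0, 0) \<noteq> 0"
  proof -
    let ?A = "{enat k | k. (d_t ^^ k) (Delta_L f) (s\<^sub>0, 0) \<noteq> 0}"
    have "Inf ?A = 2" using order by (simp add: edge_order_def)
    moreover have "?A \<noteq> {}"
    proof
      assume "?A = {}"
      then have "Inf ?A = \<infinity>" unfolding Inf_enat_def by (rule if_P)
      with \<open>Inf ?A = 2\<close> show False by simp
    qed
    then have "Inf ?A \<in> ?A" by (metis (lifting) Inf_enat_def LeastI ex_in_conv)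
    ultimately have "enat 2 \<in> ?A" by (simp add: numeral_eq_enat)
    then show ?thesis by blast
  qed
  ultimately show False by contradiction
qed

text \<open>Differentiate $\langle\Gamma',\Gamma'\rangle_L=0$ along the edge.\<close>

lemma linner_v_w:
  assumes "\<And>s. s \<in> I \<Longrightarrow> linner (d_s f (s, 0)) (d_s f (s, 0)) = 0"
  shows "linner v w = 0"
proof -
  have "((\<lambda>u. d_s f (u, 0)) has_vector_derivative w) (at s\<^sub>0)"
    unfolding w_def using axis_in_U s0 by (intro smooth_on_has_d_s[of U] smooth_derivs) simp
  then have "((\<lambda>u. linner (d_s f (u, 0)) (d_s f (u, 0))) has_vector_derivative
      linner v w + linner w v) (at s\<^sub>0)"
    unfolding v_def by (intro bounded_bilinear.has_vector_derivative[OF bounded_bilinear_linner])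
  moreover have "((\<lambda>u. linner (d_s f (u, 0)) (d_s f (u, 0))) has_vector_derivative 0) (at s\<^sub>0)"
    by (rule has_vector_derivative_transform_within_open[of "\<lambda>_. 0" _ _ I])
      (use edge assms s0 in \<open>auto simp: generalized_cuspidal_edge_def\<close>)
  ultimately have "linner v w + linner w v = 0" by (rule vector_derivative_unique_at)
  then show ?thesis by (simp add: linner_def mult.commute)
qed

end

locale light_like_edge_at = generalized_cuspidal_edge_at +
  assumes general: "light_like_general_type I \<delta> f"
begin

lemma edge_velocity_null: "s \<in> I \<Longrightarrow> linner (d_s f (s, 0)) (d_s f (s, 0)) = 0"
  using general unfolding light_like_general_type_def light_like_vec_def
  by (simp add: edge_vel_def edge_curve_def[abs_def] d_s_def)

lemma v_eq: "v = edge_vel f s\<^sub>0"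
  by (simp add: v_def edge_vel_def edge_curve_def[abs_def] d_s_def)

lemma w_eq: "w = edge_acc f s\<^sub>0"
  by (simp add: w_def edge_acc_def edge_vel_def[abs_def] edge_curve_def[abs_def] d_s_def)

lemma linner_va_nonzero: "linner v a \<noteq> 0"
  using linner_v_a_nonzero general s0 edge_velocity_null[OF s0]
  unfolding light_like_general_type_def edge_sing_def by (auto simp: v_def)

lemma det3_v_a_w_nonzero: "det3 v a w \<noteq> 0"
  using det3_light_like_nonzero[OF _ linner_v_w[OF edge_velocity_null] _ linner_va_nonzero] general s0
  unfolding light_like_general_type_def v_eq w_eq by blast

lemma sigma_C_nonzero: "sigma_C f (s\<^sub>0, 0) \<noteq> 0"
  using det3_v_a_w_nonzero by (simp add: sigma_C_def v_eq w_eq a_def sgn_eq_0_iff)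

text \<open>The limit of $tK^L$ at the edge point. Its sign decides on which side $K^L$ is positive.\<close>

definition "kappa = - (det3 v a w * (det3 v a c / 2)) / (linner v a) ^ 4"

lemma Delta_limit: "((\<lambda>q. Delta_L f q / snd q ^ 2) \<longlongrightarrow> - (linner v a)\<^sup>2) (off_axis s\<^sub>0)"
proof -
  have "((\<lambda>q. (E_L f q / snd q ^ 2) * (G_L f q / snd q ^ 2) * (snd q)\<^sup>2 - (F_L f q / snd q)\<^sup>2)
      \<longlongrightarrow> linner v b * linner a a * 0\<^sup>2 - (linner v a)\<^sup>2) (off_axis s\<^sub>0)"
    by (intro tendsto_intros E_limit edge_velocity_null G_limit F_limit snd_limit)
  moreover have "\<forall>\<^sub>F q in off_axis s\<^sub>0. (E_L f q / snd q ^ 2) * (G_L f q / snd q ^ 2) * (snd q)\<^sup>2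
      - (F_L f q / snd q)\<^sup>2 = Delta_L f q / snd q ^ 2"
    using eventually_off_axis_nonzero
    by eventually_elim (simp add: Delta_L_def field_simps power2_eq_square)
  ultimately have "((\<lambda>q. Delta_L f q / snd q ^ 2)
      \<longlongrightarrow> linner v b * linner a a * 0\<^sup>2 - (linner v a)\<^sup>2) (off_axis s\<^sub>0)"
    by (rule Lim_transform_eventually)
  then show ?thesis by simp
qed

lemma eventually_Delta_neg: "\<forall>\<^sub>F q in off_axis s\<^sub>0. Delta_L f q < 0"
proof -
  have "\<forall>\<^sub>F q in off_axis s\<^sub>0. Delta_L f q / snd q ^ 2 < 0"
    using linner_va_nonzero by (intro order_tendstoD(2)[OF Delta_limit]) simp
  then show ?thesis by eventually_elim (simp add: divide_less_0_iff)
qed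

lemma K_limit: "((\<lambda>q. snd q * K_L f q) \<longlongrightarrow> kappa) (off_axis s\<^sub>0)"
proof -
  have "((\<lambda>q. - ((L_til f q / snd q) * (N_til f q / snd q ^ 2) - snd q * (M_til f q / snd q ^ 2)\<^sup>2)
        / (Delta_L f q / snd q ^ 2)\<^sup>2)
      \<longlongrightarrow> - (det3 v a w * (det3 v a c / 2) - 0 * (det3 v a b)\<^sup>2) / (- (linner v a)\<^sup>2)\<^sup>2) (off_axis s\<^sub>0)"
    using linner_va_nonzero by (intro tendsto_intros L_limit M_limit N_limit Delta_limit snd_limit) simp
  moreover have "\<forall>\<^sub>F q in off_axis s\<^sub>0.
      - ((L_til f q / snd q) * (N_til f q / snd q ^ 2) - snd q * (M_til f q / snd q ^ 2)\<^sup>2)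
        / (Delta_L f q / snd q ^ 2)\<^sup>2 = snd q * K_L f q"
    using eventually_off_axis_nonzero eventually_Delta_neg
  proof eventually_elim
    case (elim q)
    have id: "- (l / t * (n / t ^ 2) - t * (m / t ^ 2)\<^sup>2) / (d / t ^ 2)\<^sup>2 = t * (- (l * n - m\<^sup>2) / d\<^sup>2)"
      if "t \<noteq> 0" "d \<noteq> 0" for l m n d t :: real
      using that by (simp add: field_simps power2_eq_square)
    show ?case unfolding K_L_def by (rule id) (use elim in auto)
  qed
  ultimately have "((\<lambda>q. snd q * K_L f q)
      \<longlongrightarrow> - (det3 v a w * (det3 v a c / 2) - 0 * (det3 v a b)\<^sup>2) / (- (linner v a)\<^sup>2)\<^sup>2) (off_axis s\<^sub>0)"
    by (rule Lim_transform_eventually)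
  then show ?thesis by (simp add: kappa_def power2_eq_square power4_eq_xxxx mult.assoc)
qed

text \<open>Numerator and denominator are both of order $t^3$. The absolute value is needed for a limit:
  $\sqrt{|\Delta_L|}$ is proportional to $|t|$, so $H^L$ itself may tend to different values
  on the two sides.\<close>

lemma H_bounded: "\<exists>C. \<forall>\<^sub>F q in off_axis s\<^sub>0. \<bar>H_L f q\<bar> \<le> C"
proof -
  let ?X = "\<lambda>q. snd q * (E_L f q / snd q ^ 2) * (N_til f q / snd q ^ 2)
      - 2 * (F_L f q / snd q) * (M_til f q / snd q ^ 2) + (G_L f q / snd q ^ 2) * (L_til f q / snd q)"
  let ?D = "\<lambda>q. Delta_L f q / snd q ^ 2"
  define n where "n = det3 v a c / 2"
  define C where "C = \<bar>0 * linner v b * n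
      - 2 * linner v a * det3 v a b + linner a a * det3 v a w\<bar>
      / \<bar>2 * (- (linner v a)\<^sup>2) * sqrt \<bar>- (linner v a)\<^sup>2\<bar>\<bar>"
  have "((\<lambda>q. \<bar>?X q\<bar> / \<bar>2 * ?D q * sqrt \<bar>?D q\<bar>\<bar>) \<longlongrightarrow> C) (off_axis s\<^sub>0)"
    unfolding C_def using linner_va_nonzero
    by (intro tendsto_intros E_limit edge_velocity_null F_limit G_limit L_limit M_limit
        N_limit[folded n_def] Delta_limit snd_limit)
      (simp only: abs_eq_0 mult_eq_0_iff real_sqrt_eq_0_iff power_eq_0_iff neg_equal_0_iff_equal, simp)
  then have "\<forall>\<^sub>F q in off_axis s\<^sub>0. \<bar>?X q\<bar> / \<bar>2 * ?D q * sqrt \<bar>?D q\<bar>\<bar> < C + 1"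
    by (rule order_tendstoD(2)) simp
  then have "\<forall>\<^sub>F q in off_axis s\<^sub>0. \<bar>H_L f q\<bar> \<le> C + 1"
    using eventually_off_axis_nonzero eventually_Delta_neg
  proof eventually_elim
    case (elim q)
    have num: "E_L f q * N_til f q - 2 * F_L f q * M_til f q + G_L f q * L_til f q = ?X q * snd q ^ 3"
      using elim(2) by (simp add: field_simps power2_eq_square power3_eq_cube)
    have "\<bar>2 * ?D q * sqrt \<bar>?D q\<bar>\<bar> * \<bar>snd q\<bar> ^ 3 = \<bar>2 * Delta_L f q * sqrt \<bar>Delta_L f q\<bar>\<bar>"
      using elim(2) by (simp add: abs_mult real_sqrt_divide power2_eq_square power3_eq_cube abs_divide)
    then have "\<bar>H_L f q\<bar> = (\<bar>?X q\<bar> * \<bar>snd q\<bar> ^ 3) / (\<bar>2 * ?D q * sqrt \<bar>?D q\<bar>\<bar> * \<bar>snd q\<bar> ^ 3)"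
      unfolding H_L_def num abs_divide abs_mult power_abs by simp
    also have "\<dots> = \<bar>?X q\<bar> / \<bar>2 * ?D q * sqrt \<bar>?D q\<bar>\<bar>" using elim(2) by simp
    finally show ?case using elim(1) by simp
  qed
  then show ?thesis by blast
qed

lemma discriminant_limit: "((\<lambda>q. snd q * ((H_L f q)\<^sup>2 - K_L f q)) \<longlongrightarrow> - kappa) (off_axis s\<^sub>0)"
proof -
  obtain C where C: "\<forall>\<^sub>F q in off_axis s\<^sub>0. \<bar>H_L f q\<bar> \<le> C" using H_bounded by blast
  have "((\<lambda>q. snd q * (H_L f q)\<^sup>2) \<longlongrightarrow> 0) (off_axis s\<^sub>0)"
  proof (rule tendsto_0_le[OF snd_limit, where K = "C\<^sup>2"])
    show "\<forall>\<^sub>F q in off_axis s\<^sub>0. norm (snd q * (H_L f q)\<^sup>2) \<le> norm (snd q) * C\<^sup>2"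
      using C
    proof eventually_elim
      case (elim q)
      then have "(H_L f q)\<^sup>2 \<le> C\<^sup>2" by (metis abs_ge_zero power2_abs power_mono)
      then show ?case by (simp add: abs_mult mult_left_mono)
    qed
  qed
  from tendsto_diff[OF this K_limit] show ?thesis by (simp add: algebra_simps)
qed

end

section \<open>Cuspidal edge points\<close>

lemma left_inverse_derivative_injective:
  assumes "open S" "x \<in> S" "\<And>y. y \<in> S \<Longrightarrow> k (h y) = y"
    and "(h has_derivative h') (at x)" "(k has_derivative k') (at (h x))"
    and "h' z = 0"
  shows "z = 0"
proof -
  have "((\<lambda>y. k (h y)) has_derivative (\<lambda>z. k' (h' z))) (at x)"
    using diff_chain_at[OF assms(4,5)] by (simp add: o_def)
  then have "(id has_derivative (\<lambda>z. k' (h' z))) (at x)"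
    by (rule has_derivative_transform_within_open[OF _ assms(1,2)]) (simp add: assms(3))
  then have "(\<lambda>z. k' (h' z)) = id"
    using has_derivative_id has_derivative_unique by blast
  then have "z = k' 0" using assms(6) by (metis id_apply)
  then show ?thesis using has_derivative_bounded_linear[OF assms(5)] linear_simps(3) by metis
qed

lemma diffeomorphism_derivative_injective:
  assumes "diffeomorphism_betw S T \<phi>" "x \<in> S" "frechet_derivative \<phi> (at x) z = 0"
  shows "z = 0"
proof (rule left_inverse_derivative_injective[where h = \<phi> and k = "inv_into S \<phi>"])
  show "open S" using assms(1) by (simp add: diffeomorphism_betw_def)
  show "inv_into S \<phi> (\<phi> y) = y" if "y \<in> S" for y
    using assms(1) that bij_betw_inv_into_left by (auto simp: diffeomorphism_betw_def)
  show "(\<phi> has_derivative frechet_derivative \<phi> (at x)) (at x)"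
    using assms(1,2) by (intro smooth_on_has_derivative) (auto simp: diffeomorphism_betw_def)
  show "(inv_into S \<phi> has_derivative frechet_derivative (inv_into S \<phi>) (at (\<phi> x))) (at (\<phi> x))"
    using assms(1,2) by (intro smooth_on_has_derivative) (auto simp: diffeomorphism_betw_def bij_betw_def)
qed (use assms in auto)

lemma diffeomorphism_inverse:
  assumes "diffeomorphism_betw S T \<phi>"
  shows "diffeomorphism_betw T S (inv_into S \<phi>)"
proof -
  have bij: "bij_betw \<phi> S T" and S: "open S" "smooth_on S \<phi>"
    using assms by (simp_all add: diffeomorphism_betw_def)
  have "smooth_on S (inv_into T (inv_into S \<phi>))"
    by (rule smooth_on_cong[OF S(1) _ S(2)]) (simp add: inv_into_inv_into_eq[OF bij])
  then show ?thesis
    using assms bij_betw_inv_into[OF bij] by (simp add: diffeomorphism_betw_def)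
qed

lemma det3_linear_image:
  assumes "linear A"
  shows "det3 (A x) (A y) (A z) = det (matrix A) * det3 x y z"
proof -
  have "A u = matrix A *v u" for u
    using matrix_works[of A] assms by (simp add: linear_matrix_vector_mul_eq)
  then have "(vector [A x, A y, A z] :: real^3^3) = vector [x, y, z] ** transpose (matrix A)"
    by (simp add: vec_eq_iff forall_3 matrix_matrix_mult_def transpose_def
        matrix_vector_mult_def sum_3 mult.commute)
  then show ?thesis unfolding det3_def by (simp add: det_mul det_transpose mult.commute)
qed

context generalized_cuspidal_edge_at
begin

lemma slice_limit:
  assumes "(g \<longlongrightarrow> z) (off_axis s\<^sub>0)"
  shows "((\<lambda>t. g (s\<^sub>0, t)) \<longlongrightarrow> z) (at 0)"
proof (rule filterlim_compose[OF assms])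
  show "filterlim (\<lambda>t. (s\<^sub>0, t)) (off_axis s\<^sub>0) (at 0)"
    unfolding filterlim_at
    by (auto simp: eventually_at_filter intro!: tendsto_intros)
qed

text \<open>Write $\psi\circ f=(u,\nu^2,\nu^3)$ with $(u,\nu)$ the inverse of the source diffeomorphism, and let
  $A$ be the derivative of $\psi$ at the image point. The two sides are compared along the curve
  $y(t)=f(s_0,t)$. Since $y'=O(t)$, the curve leaves its starting point at speed zero, and $\psi\circ y$
  differs from its linearization $A(y-y(0))$ only by $o(t^3)$. So $Aa/2$ and $Ac/6$
  are the coefficients of $t^2$ and $t^3$ in $(u,\nu^2,\nu^3)$. Thus
  $Av=(u_s,0,0)$, $Aa=(\ast,2\nu_t^2,0)$ and $Ac=(\ast,\ast,6\nu_t^3)$. These vectors form a triangular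
  matrix, whose diagonal is nonzero because $A$ and the derivative of $(u,\nu)$ are injective.\<close>

lemma cuspidal_edge_point_det_nonzero:
  assumes "cuspidal_edge_point I \<delta> f (s\<^sub>0, 0)"
  shows "det3 v a c \<noteq> 0"
proof -
  obtain M N P Q and \<phi> :: "real \<times> real \<Rightarrow> real \<times> real" and \<psi> :: "real^3 \<Rightarrow> real^3" where
    N: "N \<subseteq> U" and \<phi>: "diffeomorphism_betw M N \<phi>" "(0, 0) \<in> M" "\<phi> (0, 0) = (s\<^sub>0, 0)"
    and \<psi>: "diffeomorphism_betw P Q \<psi>" "f ` N \<subseteq> P" "\<psi> (f (s\<^sub>0, 0)) = 0"
    and normal_form: "\<And>x. x \<in> M \<Longrightarrow> \<psi> (f (\<phi> x)) = standard_cuspidal_edge x"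
    using assms unfolding cuspidal_edge_point_def by metis
  define \<Phi> where "\<Phi> = inv_into M \<phi>"
  have \<Phi>: "diffeomorphism_betw N M \<Phi>" unfolding \<Phi>_def by (rule diffeomorphism_inverse[OF \<phi>(1)])
  have open_N: "open N" and bij: "bij_betw \<phi> M N"
    using \<phi>(1) by (auto simp: diffeomorphism_betw_def)
  have p_N: "(s\<^sub>0, 0) \<in> N" using \<phi>(2,3) bij bij_betwE by metis
  have \<Phi>_p: "\<Phi> (s\<^sub>0, 0) = (0, 0)"
    using \<phi>(2,3) bij_betw_inv_into_left[OF bij] unfolding \<Phi>_def by metis
  have smooth_\<psi>: "smooth_on P \<psi>" and smooth_\<Phi>: "smooth_on N \<Phi>"
    using \<psi>(1) \<Phi> by (auto simp: diffeomorphism_betw_def)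
  have h: "\<psi> (f q) = vector [fst (\<Phi> q), (snd (\<Phi> q))\<^sup>2, (snd (\<Phi> q)) ^ 3]" if "q \<in> N" for q
  proof -
    have "\<Phi> q \<in> M" "\<phi> (\<Phi> q) = q"
      using \<Phi> bij bij_betw_inv_into_right that unfolding \<Phi>_def diffeomorphism_betw_def
      by (auto simp: bij_betw_def)
    with normal_form[of "\<Phi> q"] show ?thesis
      by (simp add: standard_cuspidal_edge_def case_prod_beta)
  qed
  define y where "y t = f (s\<^sub>0, t)" for t
  define A where "A = frechet_derivative \<psi> (at (y 0))"
  have y0: "y 0 = f (s\<^sub>0, 0)" by (simp add: y_def)
  have y0_P: "y 0 \<in> P" using \<psi>(2) p_N y0 by auto
  have A: "(\<psi> has_derivative A) (at (y 0))"
    unfolding A_def by (rule smooth_on_has_derivative[OF smooth_\<psi> y0_P])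
  have bl_A: "bounded_linear A" by (rule has_derivative_bounded_linear[OF A])
  have A_inj: "A z = 0 \<Longrightarrow> z = 0" for z
    using diffeomorphism_derivative_injective[OF \<psi>(1) y0_P] unfolding A_def by blast
  define B where "B = frechet_derivative \<Phi> (at (s\<^sub>0, 0))"
  have B: "(\<Phi> has_derivative B) (at (s\<^sub>0, 0))"
    unfolding B_def by (rule smooth_on_has_derivative[OF smooth_\<Phi> p_N])
  have B_inj: "B z = 0 \<Longrightarrow> z = 0" for z
    using diffeomorphism_derivative_injective[OF \<Phi> p_N] unfolding B_def by blast
  have df: "(f has_derivative frechet_derivative f (at (s\<^sub>0, 0))) (at (s\<^sub>0, 0))"
    using smooth_on_has_derivative[OF smooth_f] N p_N by blast
  (* Where the second source coordinate is 0, its square and its cube have zero derivative. *)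
  have chain: "A (frechet_derivative f (at (s\<^sub>0, 0)) z) = vector [fst (B z), 0, 0]" for z
  proof -
    have "((\<lambda>q. \<psi> (f q)) has_derivative (\<lambda>z. A (frechet_derivative f (at (s\<^sub>0, 0)) z))) (at (s\<^sub>0, 0))"
      using diff_chain_at[OF df] A unfolding y0 o_def by blast
    then have "((\<lambda>q. vector [fst (\<Phi> q), (snd (\<Phi> q))\<^sup>2, (snd (\<Phi> q)) ^ 3] :: real^3)
        has_derivative (\<lambda>z. A (frechet_derivative f (at (s\<^sub>0, 0)) z))) (at (s\<^sub>0, 0))"
      by (rule has_derivative_transform_within_open[OF _ open_N p_N]) (rule h)
    then have comp: "((\<lambda>q. (vector [fst (\<Phi> q), (snd (\<Phi> q))\<^sup>2, (snd (\<Phi> q)) ^ 3] :: real^3) $ i)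
        has_derivative (\<lambda>z. A (frechet_derivative f (at (s\<^sub>0, 0)) z) $ i)) (at (s\<^sub>0, 0))" for i
      by (rule bounded_linear.has_derivative[OF bounded_linear_vec_nth])
    have 1: "((\<lambda>q. fst (\<Phi> q)) has_derivative (\<lambda>z. fst (B z))) (at (s\<^sub>0, 0))"
      by (rule has_derivative_fst[OF B])
    have 2: "((\<lambda>q. (snd (\<Phi> q))\<^sup>2) has_derivative (\<lambda>z. 0)) (at (s\<^sub>0, 0))"
      using has_derivative_power[OF has_derivative_snd[OF B], of 2] by (simp add: \<Phi>_p)
    have 3: "((\<lambda>q. (snd (\<Phi> q)) ^ 3) has_derivative (\<lambda>z. 0)) (at (s\<^sub>0, 0))"
      using has_derivative_power[OF has_derivative_snd[OF B], of 3] by (simp add: \<Phi>_p)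
    have "A (frechet_derivative f (at (s\<^sub>0, 0)) z) $ 1 = fst (B z)"
      using fun_cong[OF has_derivative_unique[OF _ 1], of "\<lambda>z. A (frechet_derivative f (at (s\<^sub>0, 0)) z) $ 1" z]
        comp[of 1] by simp
    moreover have "A (frechet_derivative f (at (s\<^sub>0, 0)) z) $ 2 = 0"
      using fun_cong[OF has_derivative_unique[OF _ 2], of "\<lambda>z. A (frechet_derivative f (at (s\<^sub>0, 0)) z) $ 2" z]
        comp[of 2] by simp
    moreover have "A (frechet_derivative f (at (s\<^sub>0, 0)) z) $ 3 = 0"
      using fun_cong[OF has_derivative_unique[OF _ 3], of "\<lambda>z. A (frechet_derivative f (at (s\<^sub>0, 0)) z) $ 3" z]
        comp[of 3] by simp
    ultimately show ?thesis by (simp add: vec_eq_iff forall_3)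
  qed
  have Av: "A v = vector [fst (B (1, 0)), 0, 0]"
    using chain[of "(1, 0)"] d_s_eqI[OF df] by (simp add: v_def)
  have "v \<noteq> 0"
    using edge s0 unfolding generalized_cuspidal_edge_def v_def
    by (auto simp: d_s_def edge_vel_def edge_curve_def[abs_def])
  then have u_s: "A v $ 1 \<noteq> 0"
    using A_inj[of v] Av by (auto simp: vec_eq_iff forall_3)
  have "vector [fst (B (0, 1)), 0, 0] = (0 :: real^3)"
    using chain[of "(0, 1)"] d_t_eqI[OF df] f_t_axis[OF s0] linear_simps(3)[OF bl_A] by simp
  then have "fst (B (0, 1)) = 0" by (simp add: vec_eq_iff forall_3)
  then have v_t: "snd (B (0, 1)) \<noteq> 0" using B_inj[of "(0, 1)"] by (metis prod.collapse zero_prod_def zero_neq_one prod.inject)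
  define v' where "v' = snd (B (0, 1))"
  have v_limit: "((\<lambda>t. snd (\<Phi> (s\<^sub>0, t)) / t) \<longlongrightarrow> v') (at 0)"
    using has_vector_derivative_quotient_limit[OF has_vector_derivative_along_t[OF has_derivative_snd[OF B]]]
    by (simp add: \<Phi>_p v'_def divide_inverse_commute)
  obtain \<rho> where \<rho>: "\<rho> > 0" "\<And>s t. \<bar>s - s\<^sub>0\<bar> < \<rho> \<Longrightarrow> \<bar>t\<bar> < \<rho> \<Longrightarrow> (s, t) \<in> N"
    using open_contains_square[OF open_N p_N] by blast
  then have slice_N: "(s\<^sub>0, t) \<in> N" if "\<bar>t\<bar> < \<rho>" for t using that by simp
  have y_der: "(y has_vector_derivative d_t f (s\<^sub>0, t)) (at t)" if "\<bar>t\<bar> < \<rho>" for t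
    unfolding y_def using smooth_on_has_d_t[OF smooth_f] slice_N[OF that] N by blast
  (* The error of the linearization along y; its derivative r' is o(t^2), being the product of f_t = O(t)
     and of a change of the derivative of \<psi> along y, which is o(t). *)
  define r where "r t = \<psi> (y t) - A (y t - y 0)" for t
  define r' where "r' t = frechet_derivative \<psi> (at (y t)) (d_t f (s\<^sub>0, t)) - A (d_t f (s\<^sub>0, t))" for t
  have r_der: "(r has_vector_derivative r' t) (at t)" if t: "\<bar>t\<bar> < \<rho>" for t
  proof -
    have "y t \<in> P" using \<psi>(2) slice_N[OF t] by (auto simp: y_def)
    note d\<psi> = has_derivative_at_withinI[OF smooth_on_has_derivative[OF smooth_\<psi> this]]
    have 1: "((\<lambda>t. \<psi> (y t)) has_vector_derivative
        frechet_derivative \<psi> (at (y t)) (d_t f (s\<^sub>0, t))) (at t)"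
      using vector_derivative_diff_chain_within[OF y_der[OF t] d\<psi>] by (simp add: o_def)
    have 2: "((\<lambda>t. A (y t - y 0)) has_vector_derivative A (d_t f (s\<^sub>0, t))) (at t)"
      using y_der[OF t] by (intro bounded_linear.has_vector_derivative[OF bl_A])
        (simp add: has_vector_derivative_diff_const)
    show ?thesis unfolding r_def r'_def by (rule has_vector_derivative_diff[OF 1 2])
  qed
  have r'_limit: "((\<lambda>t. r' t /\<^sub>R t ^ 2) \<longlongrightarrow> 0) (at 0)"
  proof -
    let ?D = "\<lambda>i t. frechet_derivative \<psi> (at (y t)) (axis i 1)"
    have D_limit: "((\<lambda>t. (?D i t - ?D i 0) /\<^sub>R t) \<longlongrightarrow> 0) (at 0)" for i
    proof -
      let ?g = "\<lambda>x. frechet_derivative \<psi> (at x) (axis i 1)"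
      have g: "(?g has_derivative frechet_derivative ?g (at (y 0))) (at (y 0))"
        by (rule smooth_on_has_derivative[OF smooth_on_frechet_derivative[OF smooth_\<psi>] y0_P])
      have "((\<lambda>t. ?D i t) has_vector_derivative frechet_derivative ?g (at (y 0)) (d_t f (s\<^sub>0, 0))) (at 0)"
        using vector_derivative_diff_chain_within[OF y_der[of 0] has_derivative_at_withinI[OF g]] \<rho>(1)
        by (simp add: o_def)
      moreover have "frechet_derivative ?g (at (y 0)) (d_t f (s\<^sub>0, 0)) = 0"
        unfolding f_t_axis[OF s0] using linear_simps(3)[OF has_derivative_bounded_linear[OF g]] .
      ultimately show ?thesis using has_vector_derivative_quotient_limit by fastforce
    qed
    have "((\<lambda>t. \<Sum>i\<in>UNIV. (d_t f (s\<^sub>0, t) /\<^sub>R t) $ i *\<^sub>R ((?D i t - ?D i 0) /\<^sub>R t))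
        \<longlongrightarrow> (\<Sum>i\<in>UNIV. a $ i *\<^sub>R 0)) (at 0)"
      using slice_limit[OF f_t_limit] by (intro tendsto_intros D_limit) simp
    then have lim: "((\<lambda>t. \<Sum>i\<in>UNIV. (d_t f (s\<^sub>0, t) /\<^sub>R t) $ i *\<^sub>R ((?D i t - ?D i 0) /\<^sub>R t)) \<longlongrightarrow> 0) (at 0)"
      by simp
    have "\<forall>\<^sub>F t in at 0. \<bar>t\<bar> < \<rho>"
      using \<rho>(1) unfolding eventually_at by (auto simp: dist_real_def)
    then have "\<forall>\<^sub>F t in at 0. (\<Sum>i\<in>UNIV. (d_t f (s\<^sub>0, t) /\<^sub>R t) $ i *\<^sub>R ((?D i t - ?D i 0) /\<^sub>R t))
        = r' t /\<^sub>R t ^ 2"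
    proof eventually_elim
      case (elim t)
      have expand: "L z = (\<Sum>i\<in>UNIV. z $ i *\<^sub>R L (axis i 1))" if "linear L" for L :: "real^3 \<Rightarrow> real^3" and z
        using basis_expansion[of z] linear_sum[OF that] linear_scale[OF that]
        by (metis (no_types, lifting) scalar_mult_eq_scaleR sum.cong)
      have "y t \<in> P" using \<psi>(2) slice_N[OF elim] by (auto simp: y_def)
      then have lin: "linear (frechet_derivative \<psi> (at (y t)))" "linear A"
        using smooth_on_has_derivative[OF smooth_\<psi>] A has_derivative_linear by blast+
      have "r' t = (\<Sum>i\<in>UNIV. d_t f (s\<^sub>0, t) $ i *\<^sub>R (?D i t - ?D i 0))"
        unfolding r'_def expand[OF lin(1), of "d_t f (s\<^sub>0, t)"] expand[OF lin(2), of "d_t f (s\<^sub>0, t)"]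
        by (simp add: A_def scaleR_diff_right sum_subtractf)
      then show ?case
        by (simp add: scaleR_sum_right power2_eq_square mult_ac)
    qed
    from Lim_transform_eventually[OF lim this] show ?thesis .
  qed
  have r_limit: "((\<lambda>t. r t /\<^sub>R t ^ 3) \<longlongrightarrow> 0) (at 0)"
  proof -
    (* r depends on t alone and is viewed as a function on a strip of the plane. *)
    have "((\<lambda>q. r' (snd q) /\<^sub>R snd q ^ 2) \<longlongrightarrow> 0) (off_axis s\<^sub>0)"
    proof (rule filterlim_compose[OF r'_limit])
      show "filterlim snd (at 0) (off_axis s\<^sub>0)"
        using snd_limit eventually_off_axis_nonzero unfolding filterlim_at by simp
    qed
    then have "((\<lambda>q. r (snd q) /\<^sub>R snd q ^ Suc 2) \<longlongrightarrow> 0 /\<^sub>R real (Suc 2)) (off_axis s\<^sub>0)"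
    proof (rule integrate_quotient_limit[where U = "UNIV \<times> {-\<rho><..<\<rho>}", rotated -1])
      show "r (snd (s, 0)) = 0" for s :: real
        using \<psi>(3) linear_simps(3)[OF bl_A] by (simp add: r_def y0)
      show "((\<lambda>u. r (snd (s, u))) has_vector_derivative r' (snd (s, t))) (at t)"
        if "(s, t) \<in> UNIV \<times> {-\<rho><..<\<rho>}" for s t :: real
        using r_der[of t] that by auto
    qed (use \<rho>(1) in \<open>auto intro: open_Times\<close>)
    from slice_limit[OF this] show ?thesis by (simp add: numeral_3_eq_3)
  qed
  have \<psi>y: "\<psi> (y t) = A (y t - y 0) + r t" for t by (simp add: r_def)
  have cut: "\<forall>\<^sub>F t in at 0. \<bar>t\<bar> < \<rho> \<and> t \<noteq> 0"
    using \<rho>(1) unfolding eventually_at by (auto simp: dist_real_def)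
  have second: "((\<lambda>t. \<psi> (y t) /\<^sub>R t ^ 2) \<longlongrightarrow> A a /\<^sub>R 2) (at 0)"
  proof -
    have "((\<lambda>t. A ((y t - y 0) /\<^sub>R t ^ 2) + t *\<^sub>R (r t /\<^sub>R t ^ 3)) \<longlongrightarrow> A (a /\<^sub>R 2) + 0 *\<^sub>R 0) (at 0)"
      by (rule tendsto_add[OF bounded_linear.tendsto[OF bl_A
            slice_limit[OF f_taylor_2, unfolded fst_conv snd_conv y_def[symmetric]]]
          tendsto_scaleR[OF tendsto_ident_at r_limit]])
    then have "((\<lambda>t. A ((y t - y 0) /\<^sub>R t ^ 2) + t *\<^sub>R (r t /\<^sub>R t ^ 3)) \<longlongrightarrow> A a /\<^sub>R 2) (at 0)"
      by (simp add: linear_simps(5)[OF bl_A])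
    moreover have "\<forall>\<^sub>F t in at 0. A ((y t - y 0) /\<^sub>R t ^ 2) + t *\<^sub>R (r t /\<^sub>R t ^ 3) = \<psi> (y t) /\<^sub>R t ^ 2"
      using cut by eventually_elim
        (simp add: \<psi>y linear_simps(5)[OF bl_A] scaleR_add_right power3_eq_cube power2_eq_square)
    ultimately show ?thesis by (rule Lim_transform_eventually)
  qed
  have third: "((\<lambda>t. (\<psi> (y t) - (t\<^sup>2 / 2) *\<^sub>R A a) /\<^sub>R t ^ 3) \<longlongrightarrow> A c /\<^sub>R 6) (at 0)"
  proof -
    have "((\<lambda>t. A ((y t - y 0 - (t\<^sup>2 / 2) *\<^sub>R a) /\<^sub>R t ^ 3) + r t /\<^sub>R t ^ 3) \<longlongrightarrow> A (c /\<^sub>R 6) + 0) (at 0)"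
      by (rule tendsto_add[OF bounded_linear.tendsto[OF bl_A
            slice_limit[OF f_taylor_3, unfolded fst_conv snd_conv y_def[symmetric] a_def[symmetric]]]
          r_limit])
    then show ?thesis
      by (simp add: \<psi>y linear_simps(1,2,5)[OF bl_A] algebra_simps)
  qed
  have comp_2: "\<forall>\<^sub>F t in at 0. (\<psi> (y t) /\<^sub>R t ^ 2) $ 2 = (snd (\<Phi> (s\<^sub>0, t)) / t)\<^sup>2"
    using cut by eventually_elim
      (simp add: y_def h slice_N field_simps power2_eq_square power3_eq_cube)
  have comp_3: "\<forall>\<^sub>F t in at 0. (\<psi> (y t) /\<^sub>R t ^ 2) $ 3 = t * (snd (\<Phi> (s\<^sub>0, t)) / t) ^ 3"
    using cut by eventually_elim
      (simp add: y_def h slice_N field_simps power2_eq_square power3_eq_cube)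
  have comp_3': "\<forall>\<^sub>F t in at 0. (\<psi> (y t) /\<^sub>R t ^ 3) $ 3 = (snd (\<Phi> (s\<^sub>0, t)) / t) ^ 3"
    using cut by eventually_elim
      (simp add: y_def h slice_N field_simps power2_eq_square power3_eq_cube)
  have Aa_2: "A a $ 2 / 2 = v'\<^sup>2"
  proof (rule tendsto_unique[of "at (0::real)"])
    show "((\<lambda>t. (snd (\<Phi> (s\<^sub>0, t)) / t)\<^sup>2) \<longlongrightarrow> A a $ 2 / 2) (at 0)"
      using Lim_transform_eventually[OF tendsto_vec_nth[OF second, of 2] comp_2] by simp
  qed (auto intro!: tendsto_intros v_limit)
  have Aa_3: "A a $ 3 = 0"
  proof -
    have "A a $ 3 / 2 = 0 * v' ^ 3"
    proof (rule tendsto_unique[of "at (0::real)"])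
      show "((\<lambda>t. t * (snd (\<Phi> (s\<^sub>0, t)) / t) ^ 3) \<longlongrightarrow> A a $ 3 / 2) (at 0)"
        using Lim_transform_eventually[OF tendsto_vec_nth[OF second, of 3] comp_3] by simp
      show "((\<lambda>t. t * (snd (\<Phi> (s\<^sub>0, t)) / t) ^ 3) \<longlongrightarrow> 0 * v' ^ 3) (at 0)"
        by (intro tendsto_intros v_limit)
    qed auto
    then show ?thesis by simp
  qed
  have Ac_3: "A c $ 3 / 6 = v' ^ 3"
  proof (rule tendsto_unique[of "at (0::real)"])
    have "((\<lambda>t. (\<psi> (y t) /\<^sub>R t ^ 3) $ 3) \<longlongrightarrow> A c $ 3 / 6) (at 0)"
      using tendsto_vec_nth[OF third, of 3] by (simp add: Aa_3)
    from Lim_transform_eventually[OF this comp_3']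
    show "((\<lambda>t. (snd (\<Phi> (s\<^sub>0, t)) / t) ^ 3) \<longlongrightarrow> A c $ 3 / 6) (at 0)" .
  qed (auto intro!: tendsto_intros v_limit)
  have "det3 (A v) (A a) (A c) = A v $ 1 * A a $ 2 * A c $ 3"
    using Av Aa_3 by (simp add: det3_expand)
  also have "\<dots> = A v $ 1 * (2 * v'\<^sup>2) * (6 * v' ^ 3)"
    using Aa_2 Ac_3 by simp
  also have "\<dots> \<noteq> 0" using u_s v_t by (simp add: v'_def)
  finally show ?thesis
    using det3_linear_image[of A v a c] bounded_linear.linear[OF bl_A] by auto
qed

end

section \<open>Behaviour near cuspidal edge points\<close>

context light_like_edge_at
begin

lemma kappa_nonzero:
  assumes "cuspidal_edge_point I \<delta> f (s\<^sub>0, 0)"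
  shows "kappa \<noteq> 0"
  using cuspidal_edge_point_det_nonzero[OF assms] det3_v_a_w_nonzero linner_va_nonzero
  by (simp add: kappa_def)

lemma eventually_signs:
  assumes "kappa \<noteq> 0"
  shows "\<forall>\<^sub>F q in off_axis s\<^sub>0. snd q * K_L f q * kappa > 0 \<and>
    snd q * ((H_L f q)\<^sup>2 - K_L f q) * kappa < 0"
proof (rule eventually_conj)
  have "((\<lambda>q. snd q * K_L f q * kappa) \<longlongrightarrow> kappa * kappa) (off_axis s\<^sub>0)"
    by (intro tendsto_intros K_limit)
  then show "\<forall>\<^sub>F q in off_axis s\<^sub>0. snd q * K_L f q * kappa > 0"
    by (rule order_tendstoD(1)) (use assms in \<open>auto simp: zero_less_mult_iff linorder_neq_iff\<close>)
  have "((\<lambda>q. snd q * ((H_L f q)\<^sup>2 - K_L f q) * kappa) \<longlongrightarrow> - kappa * kappa) (off_axis s\<^sub>0)"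
    by (intro tendsto_mult[OF discriminant_limit tendsto_const])
  then show "\<forall>\<^sub>F q in off_axis s\<^sub>0. snd q * ((H_L f q)\<^sup>2 - K_L f q) * kappa < 0"
    by (rule order_tendstoD(2)) (use assms in \<open>auto simp: zero_less_mult_iff linorder_neq_iff\<close>)
qed

lemma eventually_in_open_off_sing:
  assumes "open V" "(s\<^sub>0, 0) \<in> V"
  shows "\<forall>\<^sub>F q in off_axis s\<^sub>0. q \<in> V - edge_sing I"
proof -
  have "\<forall>\<^sub>F q in off_axis s\<^sub>0. q \<in> V"
    using assms unfolding eventually_at_topological by blast
  with eventually_off_axis_nonzero show ?thesis
    by eventually_elim (auto simp: edge_sing_def)
qed

text \<open>If $K^L$ were bounded, $tK^L$ would tend to $0$ rather than to \<^term>\<open>kappa\<close>.\<close>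

lemma K_unbounded:
  assumes "kappa \<noteq> 0" "open V" "(s\<^sub>0, 0) \<in> V"
  shows "\<not> bounded (K_L f ` (V - edge_sing I))"
proof
  assume "bounded (K_L f ` (V - edge_sing I))"
  then obtain B where B: "\<And>q. q \<in> V - edge_sing I \<Longrightarrow> norm (K_L f q) \<le> B"
    unfolding bounded_iff by blast
  have "((\<lambda>q. snd q * K_L f q) \<longlongrightarrow> 0) (off_axis s\<^sub>0)"
  proof (rule tendsto_0_le[OF snd_limit, where K = B])
    show "\<forall>\<^sub>F q in off_axis s\<^sub>0. norm (snd q * K_L f q) \<le> norm (snd q) * B"
      using eventually_in_open_off_sing[OF assms(2,3)]
      by eventually_elim (use B in \<open>simp add: abs_mult mult_left_mono\<close>)
  qed
  then have "kappa = 0" using tendsto_unique[OF off_axis_nontrivial K_limit] by blast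
  with assms(1) show False by contradiction
qed

text \<open>Close to the point, but off the edge, the discriminant $(H^L)^2-K^L$ is nonzero. Points on the edge
  are not regular.\<close>

lemma no_accumulation:
  assumes cusp: "cuspidal_edge_point I \<delta> f (s\<^sub>0, 0)"
    and S: "\<And>q. q \<in> S \<Longrightarrow> q \<in> U \<and> regular_point f q \<and> principal_curvatures_coincide f q"
  shows "\<not> (s\<^sub>0, 0) islimpt S"
proof
  assume lim: "(s\<^sub>0, 0) islimpt S"
  have "\<forall>\<^sub>F q in off_axis s\<^sub>0. \<not> principal_curvatures_coincide f q"
    using eventually_Delta_neg eventually_signs[OF kappa_nonzero[OF cusp]]
    by eventually_elim (use principal_curvatures_not_coincide in fastforce)
  then obtain T where T: "open T" "(s\<^sub>0, 0) \<in> T"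
    "\<And>q. q \<in> T \<Longrightarrow> q \<noteq> (s\<^sub>0, 0) \<Longrightarrow> snd q \<noteq> 0 \<Longrightarrow> \<not> principal_curvatures_coincide f q"
    unfolding eventually_at_topological by auto
  obtain q where q: "q \<in> S" "q \<in> T" "q \<noteq> (s\<^sub>0, 0)"
    using lim T(1,2) unfolding islimpt_def by blast
  have "snd q \<noteq> 0"
  proof
    assume "snd q = 0"
    then have "q = (fst q, 0)" by (simp add: prod_eq_iff)
    then have "fst q \<in> I" using S[OF q(1)] axis_in_U by metis
    then have "d_t f q = 0" using f_t_axis \<open>q = (fst q, 0)\<close> by metis
    then have "0 *\<^sub>R d_s f q + 1 *\<^sub>R d_t f q = 0" by simp
    then have "\<not> regular_point f q"
      unfolding regular_point_def lin_indep2_def using zero_neq_one by metis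
    then show False using S[OF q(1)] by blast
  qed
  then show False using T(3) q S by blast
qed

end

theorem theoremD:
  fixes f :: "real \<times> real \<Rightarrow> real^3" and I :: "real set" and \<delta> :: real
  assumes "light_like_general_type I \<delta> f"
  shows "\<forall>p\<in>edge_sing I. \<exists>V\<^sub>0. open V\<^sub>0 \<and> p \<in> V\<^sub>0 \<and> V\<^sub>0 \<subseteq> edge_domain I \<delta> \<and>
    (\<forall>V. open V \<and> p \<in> V \<and> V \<subseteq> V\<^sub>0 \<longrightarrow>
      (\<forall>p'\<in>edge_sing I. sigma_C f p' \<noteq> 0) \<and>
      (\<forall>q\<in>V - edge_sing I. time_like_point f q) \<and>
      bounded (H_L f ` (V - edge_sing I)) \<and>
      (cuspidal_edge_point I \<delta> f p \<longrightarrow>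
         \<not> bounded (K_L f ` (V - edge_sing I)) \<and>
         ((\<forall>(s, t)\<in>V. (t > 0 \<longrightarrow> K_L f (s, t) > 0) \<and> (t < 0 \<longrightarrow> K_L f (s, t) < 0)) \<or>
          (\<forall>(s, t)\<in>V. (t > 0 \<longrightarrow> K_L f (s, t) < 0) \<and> (t < 0 \<longrightarrow> K_L f (s, t) > 0)))) \<and>
      (cuspidal_edge_point I \<delta> f p \<longrightarrow>
         (\<forall>\<kappa>\<^sub>1 \<kappa>\<^sub>2. (\<forall>q\<in>V - edge_sing I. principal_curvatures f q = {\<kappa>\<^sub>1 q, \<kappa>\<^sub>2 q}) \<longrightarrow>
            \<not> bounded (\<kappa>\<^sub>1 ` (V - edge_sing I)) \<and> \<not> bounded (\<kappa>\<^sub>2 ` (V - edge_sing I))) \<and>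
         ((\<forall>(s, t)\<in>V. (t > 0 \<longrightarrow> principal_curvatures f (s, t) \<subseteq> \<real>) \<and>
                     (t < 0 \<longrightarrow> principal_curvatures f (s, t) \<inter> \<real> = {})) \<or>
          (\<forall>(s, t)\<in>V. (t > 0 \<longrightarrow> principal_curvatures f (s, t) \<inter> \<real> = {}) \<and>
                     (t < 0 \<longrightarrow> principal_curvatures f (s, t) \<subseteq> \<real>)))) \<and>
      (\<forall>p'. cuspidal_edge_point I \<delta> f p' \<longrightarrow>
         \<not> p' islimpt (umbilical_points I \<delta> f) \<and> \<not> p' islimpt (quasi_umbilical_points I \<delta> f)))"
proof
  have edge_at: "light_like_edge_at I \<delta> f s" if "s \<in> I" for s
    using assms that by unfold_locales (auto simp: light_like_general_type_def)
  have sigma: "\<forall>p'\<in>edge_sing I. sigma_C f p' \<noteq> 0"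
    using light_like_edge_at.sigma_C_nonzero[OF edge_at] by (auto simp: edge_sing_def)
  have accumulation: "\<forall>p'. cuspidal_edge_point I \<delta> f p' \<longrightarrow>
      \<not> p' islimpt (umbilical_points I \<delta> f) \<and> \<not> p' islimpt (quasi_umbilical_points I \<delta> f)"
  proof (intro allI impI)
    fix p' assume cusp: "cuspidal_edge_point I \<delta> f p'"
    then obtain s where s: "s \<in> I" "p' = (s, 0)"
      unfolding cuspidal_edge_point_def edge_sing_def by auto
    show "\<not> p' islimpt (umbilical_points I \<delta> f) \<and> \<not> p' islimpt (quasi_umbilical_points I \<delta> f)"
      unfolding s(2) using cusp[unfolded s(2)]
      by (intro conjI light_like_edge_at.no_accumulation[OF edge_at[OF s(1)]])
        (simp_all add: umbilical_points_def quasi_umbilical_points_def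
          space_like_point_def time_like_point_def, blast+)
  qed
  fix p assume "p \<in> edge_sing I"
  then obtain s\<^sub>0 where s0: "s\<^sub>0 \<in> I" and p: "p = (s\<^sub>0, 0)" by (auto simp: edge_sing_def)
  interpret light_like_edge_at I \<delta> f s\<^sub>0 by (rule edge_at[OF s0])
  obtain C where C: "\<forall>\<^sub>F q in off_axis s\<^sub>0. \<bar>H_L f q\<bar> \<le> C" using H_bounded by blast
  (* All conditions that the neighbourhood has to guarantee pointwise. If kappa = 0, then the point
     is not a cuspidal edge point and the curvature signs are not claimed. *)
  define good where "good q \<longleftrightarrow> Delta_L f q < 0 \<and> \<bar>H_L f q\<bar> \<le> C \<and>
    (kappa \<noteq> 0 \<longrightarrow> snd q * K_L f q * kappa > 0 \<and> snd q * ((H_L f q)\<^sup>2 - K_L f q) * kappa < 0)" for q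
  have "\<forall>\<^sub>F q in off_axis s\<^sub>0. good q"
  proof (cases "kappa = 0")
    case True
    show ?thesis using eventually_Delta_neg C by eventually_elim (simp add: good_def True)
  next
    case False
    show ?thesis using eventually_Delta_neg C eventually_signs[OF False]
      by eventually_elim (simp add: good_def)
  qed
  then obtain S where S: "open S" "(s\<^sub>0, 0) \<in> S"
    "\<And>q. q \<in> S \<Longrightarrow> q \<noteq> (s\<^sub>0, 0) \<Longrightarrow> snd q \<noteq> 0 \<Longrightarrow> good q"
    unfolding eventually_at_topological by auto
  show "\<exists>V\<^sub>0. open V\<^sub>0 \<and> p \<in> V\<^sub>0 \<and> V\<^sub>0 \<subseteq> edge_domain I \<delta> \<and>
    (\<forall>V. open V \<and> p \<in> V \<and> V \<subseteq> V\<^sub>0 \<longrightarrow>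
      (\<forall>p'\<in>edge_sing I. sigma_C f p' \<noteq> 0) \<and>
      (\<forall>q\<in>V - edge_sing I. time_like_point f q) \<and>
      bounded (H_L f ` (V - edge_sing I)) \<and>
      (cuspidal_edge_point I \<delta> f p \<longrightarrow>
         \<not> bounded (K_L f ` (V - edge_sing I)) \<and>
         ((\<forall>(s, t)\<in>V. (t > 0 \<longrightarrow> K_L f (s, t) > 0) \<and> (t < 0 \<longrightarrow> K_L f (s, t) < 0)) \<or>
          (\<forall>(s, t)\<in>V. (t > 0 \<longrightarrow> K_L f (s, t) < 0) \<and> (t < 0 \<longrightarrow> K_L f (s, t) > 0)))) \<and>
      (cuspidal_edge_point I \<delta> f p \<longrightarrow>
         (\<forall>\<kappa>\<^sub>1 \<kappa>\<^sub>2. (\<forall>q\<in>V - edge_sing I. principal_curvatures f q = {\<kappa>\<^sub>1 q, \<kappa>\<^sub>2 q}) \<longrightarrow>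
            \<not> bounded (\<kappa>\<^sub>1 ` (V - edge_sing I)) \<and> \<not> bounded (\<kappa>\<^sub>2 ` (V - edge_sing I))) \<and>
         ((\<forall>(s, t)\<in>V. (t > 0 \<longrightarrow> principal_curvatures f (s, t) \<subseteq> \<real>) \<and>
                     (t < 0 \<longrightarrow> principal_curvatures f (s, t) \<inter> \<real> = {})) \<or>
          (\<forall>(s, t)\<in>V. (t > 0 \<longrightarrow> principal_curvatures f (s, t) \<inter> \<real> = {}) \<and>
                     (t < 0 \<longrightarrow> principal_curvatures f (s, t) \<subseteq> \<real>)))) \<and>
      (\<forall>p'. cuspidal_edge_point I \<delta> f p' \<longrightarrow>
         \<not> p' islimpt (umbilical_points I \<delta> f) \<and> \<not> p' islimpt (quasi_umbilical_points I \<delta> f)))"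
  proof (intro exI[of _ "S \<inter> U"] conjI allI impI sigma accumulation; (elim conjE)?)
    show "open (S \<inter> U)" "p \<in> S \<inter> U" "S \<inter> U \<subseteq> U"
      using S(1,2) open_U axis_in_U s0 by (auto simp: p)
  next
    fix V assume V: "open V" "p \<in> V" "V \<subseteq> S \<inter> U"
    have good: "good q" if "q \<in> V - edge_sing I" for q
    proof (rule S(3))
      have "fst q \<in> I" using that V(3) by (auto simp: edge_domain_def)
      then show "snd q \<noteq> 0" using that by (cases q) (auto simp: edge_sing_def)
      then show "q \<noteq> (s\<^sub>0, 0)" by auto
    qed (use that V in auto)
    have good': "good (s, t)" if "(s, t) \<in> V" "t \<noteq> 0" for s t
      using good that by (simp add: edge_sing_def)
    show "\<forall>q\<in>V - edge_sing I. time_like_point f q"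
      using good regular_point_if_Delta_nonzero
      by (force simp: time_like_point_def good_def)
    show "bounded (H_L f ` (V - edge_sing I))"
      unfolding bounded_iff by (intro exI[of _ C]) (use good in \<open>auto simp: good_def\<close>)
    assume cusp: "cuspidal_edge_point I \<delta> f p"
    have nz: "kappa \<noteq> 0" using kappa_nonzero cusp by (simp add: p)
    show unbounded: "\<not> bounded (K_L f ` (V - edge_sing I))"
      using K_unbounded[OF nz] V by (simp add: p)
    have root_unbounded: "\<not> bounded (\<kappa> ` (V - edge_sing I))"
      if root: "\<And>q. q \<in> V - edge_sing I \<Longrightarrow> \<kappa> q \<in> principal_curvatures f q" for \<kappa>
    proof
      assume "bounded (\<kappa> ` (V - edge_sing I))"
      then obtain B where "\<And>q. q \<in> V - edge_sing I \<Longrightarrow> norm (\<kappa> q) \<le> B"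
        unfolding bounded_iff by blast
      then have "\<bar>K_L f q\<bar> \<le> 2 * C * B + B\<^sup>2" if "q \<in> V - edge_sing I" for q
        using norm_K_L_le root good that unfolding good_def by blast
      then have "bounded (K_L f ` (V - edge_sing I))"
        unfolding bounded_iff by (intro exI[of _ "2 * C * B + B\<^sup>2"]) auto
      with unbounded show False by contradiction
    qed
    {
      fix \<kappa>\<^sub>1 \<kappa>\<^sub>2 assume "\<forall>q\<in>V - edge_sing I. principal_curvatures f q = {\<kappa>\<^sub>1 q, \<kappa>\<^sub>2 q}"
      then show "\<not> bounded (\<kappa>\<^sub>1 ` (V - edge_sing I))" "\<not> bounded (\<kappa>\<^sub>2 ` (V - edge_sing I))"
        by (intro root_unbounded; blast)+
    }
    have signs: "t * K_L f (s, t) * kappa > 0" "t * ((H_L f (s, t))\<^sup>2 - K_L f (s, t)) * kappa < 0"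
      "Delta_L f (s, t) < 0" if "(s, t) \<in> V" "t \<noteq> 0" for s t
      using good'[OF that] nz by (auto simp: good_def)
    have real_side: "principal_curvatures f (s, t) \<subseteq> \<real>"
      if "(s, t) \<in> V" "t \<noteq> 0" "K_L f (s, t) < (H_L f (s, t))\<^sup>2" for s t
      using principal_curvatures_real[OF signs(3)] that by blast
    have nonreal_side: "principal_curvatures f (s, t) \<inter> \<real> = {}"
      if "(s, t) \<in> V" "t \<noteq> 0" "(H_L f (s, t))\<^sup>2 < K_L f (s, t)" for s t
      using principal_curvatures_nonreal[OF signs(3)] that by blast
    show "(\<forall>(s, t)\<in>V. (t > 0 \<longrightarrow> K_L f (s, t) > 0) \<and> (t < 0 \<longrightarrow> K_L f (s, t) < 0)) \<or>
          (\<forall>(s, t)\<in>V. (t > 0 \<longrightarrow> K_L f (s, t) < 0) \<and> (t < 0 \<longrightarrow> K_L f (s, t) > 0))"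
    proof (cases "kappa > 0")
      case True
      have "(t > 0 \<longrightarrow> K_L f (s, t) > 0) \<and> (t < 0 \<longrightarrow> K_L f (s, t) < 0)" if "(s, t) \<in> V" for s t
        using signs(1)[OF that] True by (auto simp: zero_less_mult_iff)
      then show ?thesis by blast
    next
      case False
      have "(t > 0 \<longrightarrow> K_L f (s, t) < 0) \<and> (t < 0 \<longrightarrow> K_L f (s, t) > 0)" if "(s, t) \<in> V" for s t
        using signs(1)[OF that] False by (auto simp: zero_less_mult_iff mult_less_0_iff)
      then show ?thesis by blast
    qed
    show "(\<forall>(s, t)\<in>V. (t > 0 \<longrightarrow> principal_curvatures f (s, t) \<subseteq> \<real>) \<and>
                     (t < 0 \<longrightarrow> principal_curvatures f (s, t) \<inter> \<real> = {})) \<or>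
          (\<forall>(s, t)\<in>V. (t > 0 \<longrightarrow> principal_curvatures f (s, t) \<inter> \<real> = {}) \<and>
                     (t < 0 \<longrightarrow> principal_curvatures f (s, t) \<subseteq> \<real>))"
    proof (cases "kappa > 0")
      case True
      have discriminant: "(t > 0 \<longrightarrow> (H_L f (s, t))\<^sup>2 < K_L f (s, t)) \<and> (t < 0 \<longrightarrow> K_L f (s, t) < (H_L f (s, t))\<^sup>2)"
        if "(s, t) \<in> V" for s t
        using signs(2)[OF that] True by (auto simp: mult_less_0_iff zero_less_mult_iff)
      have "(t > 0 \<longrightarrow> principal_curvatures f (s, t) \<inter> \<real> = {}) \<and>
          (t < 0 \<longrightarrow> principal_curvatures f (s, t) \<subseteq> \<real>)" if "(s, t) \<in> V" for s t
        using discriminant[OF that] real_side[OF that] nonreal_side[OF that]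
        by (cases "t = 0") (simp, blast)
      then show ?thesis by blast
    next
      case False
      have discriminant: "(t > 0 \<longrightarrow> K_L f (s, t) < (H_L f (s, t))\<^sup>2) \<and> (t < 0 \<longrightarrow> (H_L f (s, t))\<^sup>2 < K_L f (s, t))"
        if "(s, t) \<in> V" for s t
        using signs(2)[OF that] False by (auto simp: mult_less_0_iff zero_less_mult_iff)
      have "(t > 0 \<longrightarrow> principal_curvatures f (s, t) \<subseteq> \<real>) \<and>
          (t < 0 \<longrightarrow> principal_curvatures f (s, t) \<inter> \<real> = {})" if "(s, t) \<in> V" for s t
        using discriminant[OF that] real_side[OF that] nonreal_side[OF that]
        by (cases "t = 0") (simp, blast)
      then show ?thesis by blast
    qed
  qed (use accumulation in blast)+
qed

end
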